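(* Let $0<\alpha_2<\alpha_1<1$, $c_1>0$, $c_2\ge0$, $c_1+c_2=1$. The zero state probability of the mixed time-changed Erlang queue $\{\mathcal Q^{\alpha_1,\alpha_2}(t)\}_{t\ge0}$ is given, for $t>0$, by $$p_0^{\alpha_1,\alpha_2}(t)=\sum_{m=1}^\infty\sum_{r=0}^\infty\frac{A^0_{m,r}}{c_1^{a^0_{m,r}}}\Big(c_1f_{a^0_{m,r}}^{*(a^0_{m,r})}(t)+c_2g_{a^0_{m,r}}^{*(a^0_{m,r})}(t)\Big),$$ where $a^0_{m,r}=m+r(k+1)$, $A^0_{m,r}=\dfrac{m\lambda^r(k\mu)^{m+rk-1}}{r!\,(m+rk)!}(m+r(k+1)-1)!$, $f^{*(N)}$ denotes the $N$-fold convolution of $f$, and for $N\in\mathbb N$ $$f_N(t)=t^{\alpha_1-\frac{\alpha_1-1}{N}-1}\sum_{h=0}^\infty\Big(-\frac{c_2}{c_1}\Big)^ht^{(\alpha_1-\alpha_2)h}E^{h+1}_{\alpha_1,\,\alpha_1+(\alpha_1-\alpha_2)h+\frac{1-\alpha_1}{N}}\Big(-\frac{\lambda+k\mu}{c_1}t^{\alpha_1}\Big),$$ $$g_N(t)=t^{\alpha_1-\frac{\alpha_2-1}{N}-1}\sum_{h=0}^\infty\Big(-\frac{c_2}{c_1}\Big)^ht^{(\alpha_1-\alpha_2)h}E^{h+1}_{\alpha_1,\,\alpha_1+(\alpha_1-\alpha_2)h+\frac{1-\alpha_2}{N}}\Big(-\frac{\lambda+k\mu}{c_1}t^{\alpha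_1}\Big).$$
   Context: Parameters: $\lambda>0$, $\mu>0$, $k\in\mathbb N=\{1,2,\dots\}$. Erlang queue: single-server queue with Poisson arrivals of rate $\lambda$, each service consisting of $k$ successive phases, each exponential with parameter $k\mu$, all independent. $\mathcal Q(t)=(\mathcal N(t),\mathcal S(t))$, where $\mathcal N(t)$ is the number of customers in the system and $\mathcal S(t)$ is the phase of the customer being served if $\mathcal N(t)>0$ (phases are counted down: service starts at phase $k$ and ends upon completion of phase $1$), with $\mathcal S(t)=0$ if $\mathcal N(t)=0$. Thus $\mathcal Q$ is the continuous-time Markov chain on $\mathcal H_0=\mathcal H\cup\{(0,0)\}$, $\mathcal H=\{(n,s)\in\mathbb N\times\mathbb N: s\le k\}$, with $\mathcal Q(0)=(0,0)$ and transition rates: $(0,0)\to(1,k)$ at rate $\lambda$; $(n,s)\to(n+1,s)$ at rate $\lambda$; $(n,s)\to(n,s-1)$ at rate $k\mu$ if $s\ge2$; $(n,1)\to(n-1,k)$ at rate $k\mu$ if $n\ge2$; $(1,1)\to(0,0)$ at rate $k\mu$. Inverse mixed stable subordinator: $\{D_{\alpha_1,\alpha_2}(t)\}_{t\ge0}$ is the nondecreasing Lévy process (started at $0$) with $\mathbb E(e^{-zD_{\alpha_1,\alpha_2}(t)})=e^{-t(c_1z^{\alpha_1}+c_2z^{\alpha_2})}$, $z>0$; $Y_{\alpha_1,\alpha_2}(t)=\inf\{s\ge0:D_{\alpha_1,\alpha_2}(s)>t\}$, $t>0$, $Y_{\alpha_1,\alpha_2}(0)=0$. Mixed time-changed Erlang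 queue: $\mathcal Q^{\alpha_1,\alpha_2}(t)=\mathcal Q(Y_{\alpha_1,\alpha_2}(t))$, with $\mathcal Q$ and $Y_{\alpha_1,\alpha_2}$ independent. Its zero state probability is $p_0^{\alpha_1,\alpha_2}(t)=\Pr(\mathcal Q^{\alpha_1,\alpha_2}(t)=(0,0)\mid \mathcal Q^{\alpha_1,\alpha_2}(0)=(0,0))$. Three-parameter Mittag-Leffler function: $E^\gamma_{\alpha,\beta}(t)=\sum_{r=0}^\infty\frac{\Gamma(\gamma+r)t^r}{r!\,\Gamma(\gamma)\Gamma(\alpha r+\beta)}$, $t\in\mathbb R$, $\alpha,\beta,\gamma>0$. Convolution of functions on $(0,\infty)$: $(f*g)(t)=\int_0^tf(t-u)g(u)\,\mathrm du$, $f^{*(1)}=f$, $f^{*(N+1)}=f*f^{*(N)}$. Convention $0^0=1$. *)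

theory Defs
  imports "HOL-Probability.Probability"
begin

section \<open>Continuous-time Markov chains with given transition rates\<close>

text \<open>Honest transition functions on a countable state space. Continuity at \<open>0\<close> is not
  listed, since below the entries are required to be differentiable there.\<close>

definition transition_function :: "'s set \<Rightarrow> (real \<Rightarrow> 's \<Rightarrow> 's \<Rightarrow> real) \<Rightarrow> bool" where
  "transition_function S P \<longleftrightarrow>
     (\<forall>t\<ge>0. \<forall>i\<in>S. \<forall>j\<in>S. 0 \<le> P t i j) \<and>
     (\<forall>t\<ge>0. \<forall>i\<in>S. (P t i has_sum 1) S) \<and>
     (\<forall>i\<in>S. \<forall>j\<in>S. P 0 i j = (if i = j then 1 else 0)) \<and>
     (\<forall>s\<ge>0. \<forall>t\<ge>0. \<forall>i\<in>S. \<forall>j\<in>S. ((\<lambda>l. P s i l * P t l j) has_sum P (s + t) i j) S)"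

text \<open>Only the values \<open>rate i j\<close> with \<open>i \<noteq> j\<close> matter.\<close>

definition q_matrix :: "'s set \<Rightarrow> ('s \<Rightarrow> 's \<Rightarrow> real) \<Rightarrow> 's \<Rightarrow> 's \<Rightarrow> real" where
  "q_matrix S rate i j = (if i = j then - (\<Sum>\<^sub>\<infinity>l\<in>S - {i}. rate i l) else rate i j)"

definition markov_process ::
    "'w measure \<Rightarrow> 's set \<Rightarrow> (real \<Rightarrow> 's \<Rightarrow> 's \<Rightarrow> real) \<Rightarrow> (real \<Rightarrow> 'w \<Rightarrow> 's) \<Rightarrow> bool" where
  "markov_process M S P X \<longleftrightarrow>
     (\<forall>(n::nat) (t::nat \<Rightarrow> real) (x::nat \<Rightarrow> 's).
        0 \<le> t 0 \<longrightarrow> strict_mono_on {..Suc n} t \<longrightarrow> x (Suc n) \<in> S \<longrightarrow>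
        \<P>(\<omega> in M. \<forall>i\<le>n. X (t i) \<omega> = x i) > 0 \<longrightarrow>
        \<P>(\<omega> in M. X (t (Suc n)) \<omega> = x (Suc n) \<bar> \<forall>i\<le>n. X (t i) \<omega> = x i)
          = P (t (Suc n) - t n) (x n) (x (Suc n)))"

text \<open>The paths are right-continuous with respect to the discrete topology on \<open>S\<close>. For bounded
  rates (as in the queue below) the rates determine \<open>P\<close>, and hence the law of \<open>X\<close>, uniquely.\<close>

definition markov_chain_with_rates ::
    "'w measure \<Rightarrow> 's set \<Rightarrow> ('s \<Rightarrow> 's \<Rightarrow> real) \<Rightarrow> 's \<Rightarrow> (real \<Rightarrow> 'w \<Rightarrow> 's) \<Rightarrow> bool" where
  "markov_chain_with_rates M S rate x0 X \<longleftrightarrow>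
     (\<forall>t\<ge>0. X t \<in> M \<rightarrow>\<^sub>M count_space S) \<and>
     (\<forall>\<omega>\<in>space M. \<forall>t\<ge>0. \<forall>\<^sub>F u in at_right t. X u \<omega> = X t \<omega>) \<and>
     (AE \<omega> in M. X 0 \<omega> = x0) \<and>
     (\<exists>P. transition_function S P \<and>
          (\<forall>i\<in>S. \<forall>j\<in>S.
             ((\<lambda>t. P t i j) has_real_derivative q_matrix S rate i j) (at_right 0)) \<and>
          markov_process M S P X)"

section \<open>The Erlang queue\<close>

definition erlang_states :: "nat \<Rightarrow> (nat \<times> nat) set" where
  "erlang_states k = {(n, s). 1 \<le> n \<and> 1 \<le> s \<and> s \<le> k} \<union> {(0, 0)}"

fun erlang_rate ::
    "real \<Rightarrow> real \<Rightarrow> nat \<Rightarrow> nat \<times> nat \<Rightarrow> nat \<times> nat \<Rightarrow> real" where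
  "erlang_rate lam mu k (n, s) y =
     (if n = 0 then (if y = (1, k) then lam else 0)
      else if y = (n + 1, s) then lam
      else if s \<ge> 2 \<and> y = (n, s - 1) then real k * mu
      else if s = 1 \<and> n \<ge> 2 \<and> y = (n - 1, k) then real k * mu
      else if s = 1 \<and> n = 1 \<and> y = (0, 0) then real k * mu
      else 0)"

definition erlang_queue ::
    "'w measure \<Rightarrow> real \<Rightarrow> real \<Rightarrow> nat \<Rightarrow> (real \<Rightarrow> 'w \<Rightarrow> nat \<times> nat) \<Rightarrow> bool" where
  "erlang_queue M lam mu k Q \<longleftrightarrow>
     markov_chain_with_rates M (erlang_states k) (erlang_rate lam mu k) (0, 0) Q"

section \<open>The inverse mixed stable subordinator\<close>

text \<open>Cadlag version of the definition; stochastic continuity follows from the stationarity of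
  the increments and right-continuity at \<open>0\<close>.\<close>

definition levy_process :: "'w measure \<Rightarrow> (real \<Rightarrow> 'w \<Rightarrow> real) \<Rightarrow> bool" where
  "levy_process M X \<longleftrightarrow>
     (\<forall>t\<ge>0. X t \<in> borel_measurable M) \<and>
     (AE \<omega> in M. X 0 \<omega> = 0) \<and>
     (\<forall>(n::nat) (t::nat \<Rightarrow> real). 0 \<le> t 0 \<longrightarrow> strict_mono_on {..n} t \<longrightarrow>
        prob_space.indep_vars M (\<lambda>_. borel) (\<lambda>i \<omega>. X (t (Suc i)) \<omega> - X (t i) \<omega>) {..<n}) \<and>
     (\<forall>s\<ge>0. \<forall>h\<ge>0. distr M borel (\<lambda>\<omega>. X (s + h) \<omega> - X s \<omega>) = distr M borel (X h)) \<and>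
     (\<forall>\<omega>\<in>space M. \<forall>t\<ge>0. continuous (at_right t) (\<lambda>u. X u \<omega>)) \<and>
     (\<forall>\<omega>\<in>space M. \<forall>t>0. \<exists>l. ((\<lambda>u. X u \<omega>) \<longlongrightarrow> l) (at_left t))"

definition mixed_stable_subordinator ::
    "'w measure \<Rightarrow> real \<Rightarrow> real \<Rightarrow> real \<Rightarrow> real \<Rightarrow> (real \<Rightarrow> 'w \<Rightarrow> real) \<Rightarrow> bool" where
  "mixed_stable_subordinator M \<alpha>1 \<alpha>2 c1 c2 D \<longleftrightarrow>
     levy_process M D \<and>
     (\<forall>\<omega>\<in>space M. mono_on {0..} (\<lambda>t. D t \<omega>)) \<and>
     (\<forall>t\<ge>0. \<forall>z>0. prob_space.expectation M (\<lambda>\<omega>. exp (- z * D t \<omega>))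
        = exp (- t * (c1 * z powr \<alpha>1 + c2 * z powr \<alpha>2)))"

text \<open>If the path never exceeds level \<open>t\<close> (which has probability \<open>0\<close> for the subordinators
  considered here), the infimum is over the empty set, whose value in the reals is unspecified;
  we then take the value \<open>0\<close>.\<close>

definition inverse_subordinator :: "(real \<Rightarrow> 'w \<Rightarrow> real) \<Rightarrow> real \<Rightarrow> 'w \<Rightarrow> real" where
  "inverse_subordinator D t \<omega> =
     (if t = 0 \<or> {s. 0 \<le> s \<and> t < D s \<omega>} = {} then 0 else Inf {s. 0 \<le> s \<and> t < D s \<omega>})"

section \<open>The time-changed queue\<close>

definition generated_events ::
    "'w measure \<Rightarrow> 'b measure \<Rightarrow> (real \<Rightarrow> 'w \<Rightarrow> 'b) \<Rightarrow> 'w set set" where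
  "generated_events M N X =
     sigma_sets (space M) {X t -` A \<inter> space M | t A. 0 \<le> t \<and> A \<in> sets N}"

definition indep_processes ::
    "'w measure \<Rightarrow> 'b measure \<Rightarrow> (real \<Rightarrow> 'w \<Rightarrow> 'b) \<Rightarrow> 'c measure \<Rightarrow> (real \<Rightarrow> 'w \<Rightarrow> 'c) \<Rightarrow> bool" where
  "indep_processes M N X K Y \<longleftrightarrow>
     prob_space.indep_set M (generated_events M N X) (generated_events M K Y)"

definition time_changed ::
    "(real \<Rightarrow> 'w \<Rightarrow> 's) \<Rightarrow> (real \<Rightarrow> 'w \<Rightarrow> real) \<Rightarrow> real \<Rightarrow> 'w \<Rightarrow> 's" where
  "time_changed X Y t \<omega> = X (Y t \<omega>) \<omega>"

definition zero_state_probability ::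
    "'w measure \<Rightarrow> (real \<Rightarrow> 'w \<Rightarrow> nat \<times> nat) \<Rightarrow> real \<Rightarrow> real" where
  "zero_state_probability M Z t = \<P>(\<omega> in M. Z t \<omega> = (0, 0) \<bar> Z 0 \<omega> = (0, 0))"

section \<open>Mittag-Leffler functions, convolutions and coefficients\<close>

definition mittag_leffler3 :: "real \<Rightarrow> real \<Rightarrow> real \<Rightarrow> real \<Rightarrow> real" where
  "mittag_leffler3 \<alpha> \<beta> \<gamma> t =
     (\<Sum>r. Gamma (\<gamma> + real r) * t ^ r / (fact r * Gamma \<gamma> * Gamma (\<alpha> * real r + \<beta>)))"

definition convolution_half_line :: "(real \<Rightarrow> real) \<Rightarrow> (real \<Rightarrow> real) \<Rightarrow> real \<Rightarrow> real" where
  "convolution_half_line f g t = (LBINT u:{0<..<t}. f (t - u) * g u)"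

text \<open>\<open>f\<close> convolved with itself, \<open>N\<close> factors; meaningful for \<open>N \<ge> 1\<close> only.\<close>

definition convolution_power :: "nat \<Rightarrow> (real \<Rightarrow> real) \<Rightarrow> real \<Rightarrow> real" where
  "convolution_power N f = (convolution_half_line f ^^ (N - 1)) f"

definition queue_f ::
    "real \<Rightarrow> real \<Rightarrow> nat \<Rightarrow> real \<Rightarrow> real \<Rightarrow> real \<Rightarrow> real \<Rightarrow> nat \<Rightarrow> real \<Rightarrow> real" where
  "queue_f lam mu k \<alpha>1 \<alpha>2 c1 c2 N t =
     t powr (\<alpha>1 - (\<alpha>1 - 1) / real N - 1) *
     (\<Sum>h. (- (c2 / c1)) ^ h * t powr ((\<alpha>1 - \<alpha>2) * real h) *
        mittag_leffler3 \<alpha>1 (\<alpha>1 + (\<alpha>1 - \<alpha>2) * real h + (1 - \<alpha>1) / real N) (real h + 1)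
          (- ((lam + real k * mu) / c1) * t powr \<alpha>1))"

definition queue_g ::
    "real \<Rightarrow> real \<Rightarrow> nat \<Rightarrow> real \<Rightarrow> real \<Rightarrow> real \<Rightarrow> real \<Rightarrow> nat \<Rightarrow> real \<Rightarrow> real" where
  "queue_g lam mu k \<alpha>1 \<alpha>2 c1 c2 N t =
     t powr (\<alpha>1 - (\<alpha>2 - 1) / real N - 1) *
     (\<Sum>h. (- (c2 / c1)) ^ h * t powr ((\<alpha>1 - \<alpha>2) * real h) *
        mittag_leffler3 \<alpha>1 (\<alpha>1 + (\<alpha>1 - \<alpha>2) * real h + (1 - \<alpha>2) / real N) (real h + 1)
          (- ((lam + real k * mu) / c1) * t powr \<alpha>1))"

definition a0 :: "nat \<Rightarrow> nat \<Rightarrow> nat \<Rightarrow> nat" where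
  "a0 k m r = m + r * (k + 1)"

definition A0 :: "real \<Rightarrow> real \<Rightarrow> nat \<Rightarrow> nat \<Rightarrow> nat \<Rightarrow> real" where
  "A0 lam mu k m r =
     real m * lam ^ r * (real k * mu) ^ (m + r * k - 1) / (fact r * fact (m + r * k))
       * fact (m + r * (k + 1) - 1)"

definition zero_state_term ::
    "real \<Rightarrow> real \<Rightarrow> nat \<Rightarrow> real \<Rightarrow> real \<Rightarrow> real \<Rightarrow> real \<Rightarrow> real \<Rightarrow> nat \<Rightarrow> nat \<Rightarrow> real" where
  "zero_state_term lam mu k \<alpha>1 \<alpha>2 c1 c2 t m r =
     A0 lam mu k m r / c1 ^ a0 k m r *
       (c1 * convolution_power (a0 k m r) (queue_f lam mu k \<alpha>1 \<alpha>2 c1 c2 (a0 k m r)) t +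
        c2 * convolution_power (a0 k m r) (queue_g lam mu k \<alpha>1 \<alpha>2 c1 c2 (a0 k m r)) t)"

end

theory Submission
  imports Defs
begin

text \<open>
  Conditioning on the time change turns the zero state probability into the expectation of
  \<open>p\<^sub>0(Y(t))\<close>, where \<open>p\<^sub>0\<close> is the zero state probability of the Erlang queue. Counting phases,
  \<open>exp ((\<lambda> + k\<mu>) t) p\<^sub>0(t)\<close> is a power series with non-negative coefficients given by a ballot-type
  formula, so it suffices to compute \<open>h\<^sub>n(t) = E(Y(t)^n exp (- (\<lambda> + k\<mu>) Y(t)) / n!)\<close>. At an
  independent exponential time of rate \<open>z\<close> the variable \<open>Y\<close> is exponential of rate
  \<open>\<psi>(z) = c\<^sub>1 z^\<alpha>\<^sub>1 + c\<^sub>2 z^\<alpha>\<^sub>2\<close>, hence the Laplace transform of \<open>h\<^sub>n\<close> is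
  \<open>\<psi>(z) / z / (\<lambda> + k\<mu> + \<psi>(z))^(n + 1)\<close>. Expanding the Mittag-Leffler functions into powers of \<open>t\<close>
  shows that the convolution powers of \<open>f\<close> and \<open>g\<close> have the matching transforms, and both sides are
  right-continuous, so they agree at every \<open>t > 0\<close>.
\<close>

section \<open>Series of gamma kernels\<close>

text \<open>Neither side can be compared directly: one contains convolution powers of double series,
  and no density of \<open>Y\<close> is at hand. The analytic side is therefore written in the
  kernels \<open>t powr (b - 1) / Gamma b\<close>, which have transform \<open>z powr - b\<close>
  and are closed under convolution. A number \<open>Z\<close> at which the double geometric series
  behind the Mittag-Leffler expansions converges absolutely then controls every interchange of sum
  and integral, and transforms on \<open>[Z, \<infinity>)\<close> alone determine the functions.

  The shape of \<open>f_N\<close> and \<open>g_N\<close> comes from the factor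
  \<open>\<psi>(z) / z = c1 z^(\<alpha>1 - 1) + c2 z^(\<alpha>2 - 1)\<close>: it is the same for
  every \<open>N\<close>, so each of the \<open>N\<close> convolution factors carries the
  \<open>N\<close>-th part of an exponent \<open>\<alpha>i - 1\<close>, and the two summands of
  \<open>\<psi>\<close> lead to two families. These series have coefficients of both signs, whereas
  on the probabilistic side all terms are non-negative with a probability as their sum, so that
  series and expectation commute.\<close>

definition gamma_kernel :: "real \<Rightarrow> real \<Rightarrow> real" where
  "gamma_kernel b t = t powr (b - 1) / Gamma b"

lemma gamma_kernel_measurable [measurable]: "gamma_kernel b \<in> borel_measurable borel"
  unfolding gamma_kernel_def by measurable

lemma gamma_kernel_nonneg: "0 < b \<Longrightarrow> 0 \<le> gamma_kernel b t"
  by (simp add: gamma_kernel_def Gamma_real_pos less_imp_le)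

lemma has_bochner_integral_gamma_kernel_exp:
  assumes b: "0 < b" and z: "0 < z"
  shows "has_bochner_integral lborel
    (\<lambda>t. indicator {0<..} t * (gamma_kernel b t * exp (- (z * t)))) (z powr - b)"
proof (rule has_bochner_integral_nn_integral)
  have Gp: "Gamma b > 0" using b by (rule Gamma_real_pos)
  have "ennreal (Gamma b) = (\<integral>\<^sup>+t. ennreal (indicator {0..} t * t powr (b - 1) / exp t) \<partial>lborel)"
    using Gamma_conv_nn_integral_real[OF b] .
  also have "\<dots> = ennreal \<bar>z\<bar> *
     (\<integral>\<^sup>+t. ennreal (indicator {0..} (0 + z * t) * (0 + z * t) powr (b - 1) / exp (0 + z * t)) \<partial>lborel)"
    by (rule nn_integral_real_affine) (use z in auto)
  also have "(\<integral>\<^sup>+t. ennreal (indicator {0..} (0 + z * t) * (0 + z * t) powr (b - 1) / exp (0 + z * t)) \<partial>lborel)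
     = (\<integral>\<^sup>+t. ennreal (z powr (b - 1) * Gamma b) * ennreal (indicator {0<..} t * (gamma_kernel b t * exp (- (z * t)))) \<partial>lborel)"
  proof (rule nn_integral_cong_AE, rule AE_I[of _ _ "{0}"])
    show "{t \<in> space lborel. \<not> ennreal (indicator {0..} (0 + z * t) * (0 + z * t) powr (b - 1) / exp (0 + z * t)) =
        ennreal (z powr (b - 1) * Gamma b) * ennreal (indicator {0<..} t * (gamma_kernel b t * exp (- (z * t))))} \<subseteq> {0}"
      using z Gp b by (auto simp: gamma_kernel_def indicator_def less_imp_neq[symmetric] ennreal_mult[symmetric] powr_mult
          exp_minus field_simps zero_le_mult_iff split: if_splits)
  qed auto
  also have "\<dots> = ennreal (z powr (b - 1) * Gamma b) *
      (\<integral>\<^sup>+t. ennreal (indicator {0<..} t * (gamma_kernel b t * exp (- (z * t)))) \<partial>lborel)"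
    by (rule nn_integral_cmult) measurable
  also have "ennreal \<bar>z\<bar> * (ennreal (z powr (b - 1) * Gamma b) *
      (\<integral>\<^sup>+t. ennreal (indicator {0<..} t * (gamma_kernel b t * exp (- (z * t)))) \<partial>lborel))
     = ennreal (z powr b * Gamma b) *
      (\<integral>\<^sup>+t. ennreal (indicator {0<..} t * (gamma_kernel b t * exp (- (z * t)))) \<partial>lborel)"
    using z Gp by (simp add: mult.assoc[symmetric] ennreal_mult[symmetric] powr_mult_base)
  finally have *: "ennreal (Gamma b) = ennreal (z powr b * Gamma b) *
      (\<integral>\<^sup>+t. ennreal (indicator {0<..} t * (gamma_kernel b t * exp (- (z * t)))) \<partial>lborel)"
    (is "_ = _ * ?I") .
  have "ennreal (inverse (z powr b * Gamma b)) * ennreal (Gamma b) = ?I"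
    unfolding * using z Gp by (subst mult.assoc[symmetric], subst ennreal_mult[symmetric]) (auto simp: field_simps)
  then show "?I = ennreal (z powr - b)"
    using z Gp by (simp add: ennreal_mult[symmetric] powr_minus field_simps)
qed (use z b gamma_kernel_nonneg[OF b] in \<open>auto\<close>)

text \<open>The substitution \<open>u = t * x\<close> leaves the integral \<open>Beta b a\<close>,
  whose Gamma factors cancel those of the two kernels; the kernels thus form a convolution semigroup
  in the index.\<close>

lemma has_bochner_integral_gamma_kernel_conv:
  assumes a: "0 < a" and b: "0 < b" and t: "0 < t"
  shows "has_bochner_integral lborel
    (\<lambda>u. indicator {0<..<t} u * (gamma_kernel a (t - u) * gamma_kernel b u)) (gamma_kernel (a + b) t)"
proof (rule has_bochner_integral_nn_integral)
  have Gp: "Gamma a > 0" "Gamma b > 0" "Gamma (a + b) > 0" using a b by (auto intro!: Gamma_real_pos)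
  have "((\<lambda>t. t powr (b - 1) * (1 - t) powr (a - 1)) has_integral Beta b a) {0..1}"
    by (rule has_integral_Beta_real[OF b a])
  then have B: "(\<integral>\<^sup>+x. ennreal (indicator {0..1} x * (x powr (b - 1) * (1 - x) powr (a - 1))) \<partial>lborel) = ennreal (Beta b a)"
    by (intro nn_integral_has_integral_lebesgue) auto
  have "(\<integral>\<^sup>+u. ennreal (indicator {0<..<t} u * (gamma_kernel a (t - u) * gamma_kernel b u)) \<partial>lborel)
    = ennreal \<bar>t\<bar> * (\<integral>\<^sup>+x. ennreal (indicator {0<..<t} (0 + t * x) * (gamma_kernel a (t - (0 + t * x)) * gamma_kernel b (0 + t * x))) \<partial>lborel)"
    by (rule nn_integral_real_affine) (use t in auto)
  also have "(\<integral>\<^sup>+x. ennreal (indicator {0<..<t} (0 + t * x) * (gamma_kernel a (t - (0 + t * x)) * gamma_kernel b (0 + t * x))) \<partial>lborel)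
    = (\<integral>\<^sup>+x. ennreal (t powr (a + b - 2) / (Gamma a * Gamma b)) * ennreal (indicator {0..1} x * (x powr (b - 1) * (1 - x) powr (a - 1))) \<partial>lborel)"
  proof (rule nn_integral_cong_AE, rule AE_I[of _ _ "{0,1}"])
    have 1: "t - t * x = t * (1 - x)" for x by (simp add: algebra_simps)
    have 2: "t powr (a - 1) * t powr (b - 1) = t powr (a + b - 2)"
      using t by (simp add: powr_add[symmetric])
    have "ennreal (indicator {0<..<t} (0 + t * x) * (gamma_kernel a (t - (0 + t * x)) * gamma_kernel b (0 + t * x))) =
        ennreal (t powr (a + b - 2) / (Gamma a * Gamma b)) * ennreal (indicator {0..1} x * (x powr (b - 1) * (1 - x) powr (a - 1)))"
      if "x \<noteq> 0" "x \<noteq> 1" for x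
    proof (cases "0 < x \<and> x < 1")
      case True
      then have "0 < t * x" "t * x < t" using t by auto
      then show ?thesis using True t Gp
        by (simp add: ennreal_mult[symmetric] gamma_kernel_def 1 powr_mult 2[symmetric] indicator_def)
    next
      case False
      then have "\<not> (0 < t * x \<and> t * x < t)" "\<not> (0 \<le> x \<and> x \<le> 1)" using t that
        by (auto simp: zero_less_mult_iff)
      then show ?thesis by (auto simp: indicator_def)
    qed
    then show "{x \<in> space lborel. \<not> ennreal (indicator {0<..<t} (0 + t * x) * (gamma_kernel a (t - (0 + t * x)) * gamma_kernel b (0 + t * x))) =
        ennreal (t powr (a + b - 2) / (Gamma a * Gamma b)) * ennreal (indicator {0..1} x * (x powr (b - 1) * (1 - x) powr (a - 1)))} \<subseteq> {0, 1}"
      by blast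
  qed (auto intro!: emeasure_lborel_countable)
  also have "\<dots> = ennreal (t powr (a + b - 2) / (Gamma a * Gamma b)) * ennreal (Beta b a)"
    by (subst nn_integral_cmult) (auto simp: B)
  also have "ennreal \<bar>t\<bar> * \<dots> = ennreal (gamma_kernel (a + b) t)"
  proof -
    have "t * t powr (a + b - 2) = t powr (a + b - 1)"
      using t by (subst powr_mult_base) (auto simp: algebra_simps)
    then show ?thesis using t Gp
      by (simp add: ennreal_mult[symmetric] Beta_def gamma_kernel_def field_simps)
  qed
  finally show "(\<integral>\<^sup>+u. ennreal (indicator {0<..<t} u * (gamma_kernel a (t - u) * gamma_kernel b u)) \<partial>lborel) = ennreal (gamma_kernel (a + b) t)" .
qed (use gamma_kernel_nonneg[OF a] gamma_kernel_nonneg[OF b] gamma_kernel_nonneg[of "a+b"] a b in \<open>auto simp: indicator_def\<close>)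

text \<open>Restrict the Laplace integral of the kernel to \<open>[t, 2t]\<close>, where the kernel is at least half its
  value at \<open>t\<close>; the bound separates \<open>b\<close> from \<open>t\<close>.\<close>

lemma gamma_kernel_le:
  assumes b: "0 < b" and z: "0 < z" and t: "0 < t"
  shows "gamma_kernel b t \<le> 2 * exp (2 * z * t) / t * z powr - b"
proof -
  have Gp: "Gamma b > 0" using b by (rule Gamma_real_pos)
  have I: "has_bochner_integral lborel
    (\<lambda>s. indicator {t..2*t} s * (gamma_kernel b t / 2 * exp (- (2 * z * t)))) (t * (gamma_kernel b t / 2 * exp (- (2 * z * t))))"
    using has_bochner_integral_real_indicator[of "{t..2*t}" lborel] t
    by (intro has_bochner_integral_mult_left) auto
  have "t * (gamma_kernel b t / 2 * exp (- (2 * z * t))) \<le> z powr - b"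
    unfolding has_bochner_integral_integral_eq[OF I, symmetric]
      has_bochner_integral_integral_eq[OF has_bochner_integral_gamma_kernel_exp[OF b z], symmetric]
  proof (rule integral_mono)
    show "integrable lborel (\<lambda>s. indicator {t..2*t} s * (gamma_kernel b t / 2 * exp (- (2 * z * t))))"
      "integrable lborel (\<lambda>s. indicator {0<..} s * (gamma_kernel b s * exp (- (z * s))))"
      using I has_bochner_integral_gamma_kernel_exp[OF b z] by (auto dest: integrable.intros)
    fix s :: real
    show "indicator {t..2*t} s * (gamma_kernel b t / 2 * exp (- (2 * z * t)))
      \<le> indicator {0<..} s * (gamma_kernel b s * exp (- (z * s)))"
    proof (cases "s \<in> {t..2*t}")
      case True
      then have s: "t \<le> s" "s \<le> 2 * t" "0 < s" using t by auto
      \<comment> \<open>The exponent \<open>b - 1\<close> may have either sign, but \<open>b\<close>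
        is positive: once the increasing factor \<open>t powr b\<close> is split off, only
        \<open>1 / (2 * t) \<le> 1 / s\<close> remains.\<close>
      have "t powr (b - 1) / 2 = t powr b / (2 * t)" using t by (simp add: powr_diff)
      also have "\<dots> \<le> s powr b / s" using s t b by (intro frac_le powr_mono2) auto
      also have "\<dots> = s powr (b - 1)" using s by (simp add: powr_diff)
      finally have "gamma_kernel b t / 2 \<le> gamma_kernel b s"
        using Gp by (simp add: gamma_kernel_def divide_right_mono field_simps)
      moreover have "exp (- (2 * z * t)) \<le> exp (- (z * s))" using s z by simp
      ultimately have "gamma_kernel b t / 2 * exp (- (2 * z * t)) \<le> gamma_kernel b s * exp (- (z * s))"
        using gamma_kernel_nonneg[OF b] by (intro mult_mono) auto
      then show ?thesis using True s by simp
    qed (auto simp: indicator_def gamma_kernel_nonneg[OF b])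
  qed
  then show ?thesis using t by (simp add: exp_minus field_simps)
qed


section \<open>Absolutely summable double families and superpositions of kernels\<close>

abbreviation norm_summable_on :: "('i \<Rightarrow> real) \<Rightarrow> 'i set \<Rightarrow> bool" (infix "norm'_summable'_on" 46) where
  "f norm_summable_on A \<equiv> (\<lambda>i. norm (f i)) summable_on A"

lemma has_sum_prod_times:
  fixes x :: "'a \<Rightarrow> real" and y :: "'b \<Rightarrow> real"
  assumes x: "x norm_summable_on UNIV" "(x has_sum X) UNIV"
    and y: "y norm_summable_on UNIV" "(y has_sum Y) UNIV"
  shows "(\<lambda>(i, j). x i * y j) norm_summable_on UNIV" "((\<lambda>(i, j). x i * y j) has_sum X * Y) UNIV"
proof -
  have "(\<lambda>p. norm (case p of (i, j) \<Rightarrow> x i * y j)) summable_on (SIGMA i:UNIV. UNIV)"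
  proof (rule summable_on_SigmaI)
    show "((\<lambda>j. norm (case (i, j) of (i, j) \<Rightarrow> x i * y j)) has_sum norm (x i) * infsum (\<lambda>j. norm (y j)) UNIV) UNIV" for i
      using y(1) by (auto simp: norm_mult abs_mult intro!: has_sum_cmult_right)
    show "(\<lambda>i. norm (x i) * infsum (\<lambda>j. norm (y j)) UNIV) summable_on UNIV"
      using x(1) by (rule summable_on_cmult_left)
  qed auto
  then show 1: "(\<lambda>(i, j). x i * y j) norm_summable_on UNIV" by simp
  have "((\<lambda>(i, j). x i * y j) has_sum X * Y) (SIGMA i:UNIV. UNIV)"
  proof (rule has_sum_SigmaI)
    show "((\<lambda>j. case (i, j) of (i, j) \<Rightarrow> x i * y j) has_sum x i * Y) UNIV" for i
      using y(2) by (auto intro!: has_sum_cmult_right)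
    show "((\<lambda>i. x i * Y) has_sum X * Y) UNIV" using x(2) by (rule has_sum_cmult_left)
    show "(\<lambda>(i, j). x i * y j) summable_on (SIGMA i:UNIV. UNIV)"
      using abs_summable_summable[OF 1] by simp
  qed
  then show "((\<lambda>(i, j). x i * y j) has_sum X * Y) UNIV" by simp
qed

text \<open>Grouped by \<open>n = h + r\<close>, the family has the binomial rows
  \<open>(x + y) ^ n\<close>, whose sum is geometric. The hypothesis concerns absolute values
  because \<open>x\<close> and \<open>y\<close> are non-positive in the application and the
  regrouping rests on absolute summability.\<close>

lemma has_sum_binomial_geometric:
  fixes x y :: real
  assumes "\<bar>x\<bar> + \<bar>y\<bar> < 1"
  shows "((\<lambda>(h, r). real (h + r choose r) * (x ^ h * y ^ r)) has_sum 1 / (1 - (x + y))) UNIV"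
    and "(\<lambda>(h, r). real (h + r choose r) * (x ^ h * y ^ r)) norm_summable_on UNIV"
proof -
  have inner: "((\<lambda>r. real (n choose r) * (x ^ (n - r) * y ^ r)) has_sum (x + y) ^ n) {..n}" for x y :: real and n
  proof -
    have "(x + y) ^ n = (\<Sum>r\<le>n. real (n choose r) * (x ^ (n - r) * y ^ r))"
      unfolding add.commute[of x] binomial_ring by (intro sum.cong) auto
    then show ?thesis by (simp add: has_sum_finite)
  qed
  have geo: "((\<lambda>n. z ^ n) has_sum 1 / (1 - z)) UNIV" if "\<bar>z\<bar> < 1" for z :: real
    using that geometric_sums[of z] by (intro norm_summable_imp_has_sum) (auto simp: summable_geometric power_abs)
  let ?g = "\<lambda>x y. \<lambda>(n, r). real (n choose r) * (x ^ (n - r) * y ^ r)"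
  have nn: "(?g x y) summable_on (SIGMA n:UNIV. {..n})" if "0 \<le> x" "0 \<le> y" "x + y < 1" for x y :: real
    using inner[of _ x y] geo[of "x + y"] that
    by (intro summable_on_SigmaI[where g="\<lambda>n. (x + y) ^ n"]) (auto simp: summable_on_def)
  have abs: "(\<lambda>p. norm (?g x y p)) summable_on (SIGMA n:UNIV. {..n})"
    using nn[of "\<bar>x\<bar>" "\<bar>y\<bar>"] assms by (simp add: case_prod_unfold abs_mult power_abs)
  have "(?g x y has_sum 1 / (1 - (x + y))) (SIGMA n:UNIV. {..n})"
    using inner[of _ x y] geo[of "x + y"] assms abs_summable_summable[OF abs]
    by (intro has_sum_SigmaI[where g="\<lambda>n. (x + y) ^ n"]) auto
  also have "?this \<longleftrightarrow> ((\<lambda>(h, r). real (h + r choose r) * (x ^ h * y ^ r)) has_sum 1 / (1 - (x + y))) UNIV"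
    by (rule has_sum_reindex_bij_witness[where i="\<lambda>(h, r). (h + r, r)" and j="\<lambda>(n, r). (n - r, r)"]) auto
  finally show "((\<lambda>(h, r). real (h + r choose r) * (x ^ h * y ^ r)) has_sum 1 / (1 - (x + y))) UNIV" .
  note abs
  also have "(\<lambda>p. norm (?g x y p)) summable_on (SIGMA n:UNIV. {..n}) \<longleftrightarrow> (\<lambda>p. norm ((\<lambda>(h, r). real (h + r choose r) * (x ^ h * y ^ r)) p)) summable_on UNIV"
    by (rule summable_on_reindex_bij_witness[where i="\<lambda>(h, r). (h + r, r)" and j="\<lambda>(n, r). (n - r, r)"]) auto
  finally show "(\<lambda>(h, r). real (h + r choose r) * (x ^ h * y ^ r)) norm_summable_on UNIV" .
qed

text \<open>Through the kernel bound, absolute convergence of the transform series at the single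
  point \<open>Z\<close> carries over to the series in time, at every \<open>t\<close>.\<close>

lemma norm_summable_on_gamma_kernel:
  assumes c: "(\<lambda>i. c i * Z powr - b i) norm_summable_on A" and Z: "0 < Z" and b: "\<And>i. i \<in> A \<Longrightarrow> 0 < b i" and t: "0 < t"
  shows "(\<lambda>i. c i * gamma_kernel (b i) t) norm_summable_on A"
proof (rule summable_on_comparison_test)
  show "(\<lambda>i. 2 * exp (2 * Z * t) / t * norm (c i * Z powr - b i)) summable_on A"
    by (intro summable_on_cmult_right c)
  show "norm (c i * gamma_kernel (b i) t) \<le> 2 * exp (2 * Z * t) / t * norm (c i * Z powr - b i)" if "i \<in> A" for i
    using mult_left_mono[OF gamma_kernel_le[OF b[OF that] Z t], of "\<bar>c i\<bar>"] gamma_kernel_nonneg[OF b[OF that]]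
    by (simp add: abs_mult mult_ac)
qed auto

text \<open>A superposition \<open>F\<close> of gamma kernels together with its transform
  \<open>l\<close>. Absolute convergence is demanded at \<open>Z\<close> only; from there it
  dominates all \<open>z \<ge> Z\<close> and, through the kernel bound, all \<open>t > 0\<close>. No
  order is imposed on the indices, so products of such series stay in the class.\<close>

definition gamma_series :: "real \<Rightarrow> (real \<Rightarrow> real) \<Rightarrow> (real \<Rightarrow> real) \<Rightarrow> bool" where
  "gamma_series Z F l \<longleftrightarrow> (\<exists>(c :: nat \<Rightarrow> real) b.
     (\<forall>i. 0 < b i) \<and> (\<lambda>i. c i * Z powr - b i) norm_summable_on UNIV \<and>
     (\<forall>t>0. ((\<lambda>i. c i * gamma_kernel (b i) t) has_sum F t) UNIV) \<and>
     (\<forall>z\<ge>Z. ((\<lambda>i. c i * z powr - b i) has_sum l z) UNIV))"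

text \<open>Both uses produce families indexed by pairs: the two summation indices of a
  Mittag-Leffler expansion, and the product of two series. The pairing bijection brings them to the
  index set of the definition.\<close>

lemma gamma_seriesI:
  fixes c b :: "nat \<times> nat \<Rightarrow> real"
  assumes "\<And>p. 0 < b p" "(\<lambda>p. c p * Z powr - b p) norm_summable_on UNIV"
    "\<And>t. 0 < t \<Longrightarrow> ((\<lambda>p. c p * gamma_kernel (b p) t) has_sum F t) UNIV"
    "\<And>z. Z \<le> z \<Longrightarrow> ((\<lambda>p. c p * z powr - b p) has_sum l z) UNIV"
  shows "gamma_series Z F l"
  unfolding gamma_series_def
  using assms summable_on_reindex_bij_betw[OF bij_prod_decode, of "\<lambda>p. norm (c p * Z powr - b p)"]
    has_sum_reindex_bij_betw[OF bij_prod_decode, of "\<lambda>p. c p * gamma_kernel (b p) t" "F t" for t]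
    has_sum_reindex_bij_betw[OF bij_prod_decode, of "\<lambda>p. c p * z powr - b p" "l z" for z]
  by (intro exI[of _ "c \<circ> prod_decode"] exI[of _ "b \<circ> prod_decode"]) auto

lemma gamma_series_continuous_on:
  assumes "gamma_series Z F l" "0 < Z"
  shows "continuous_on {0<..} F"
proof -
  obtain c :: "nat \<Rightarrow> real" and b where b: "\<And>i. 0 < b i"
    and s: "(\<lambda>i. c i * Z powr - b i) norm_summable_on UNIV"
    and F: "\<And>t. 0 < t \<Longrightarrow> ((\<lambda>i. c i * gamma_kernel (b i) t) has_sum F t) UNIV"
    using assms(1) unfolding gamma_series_def by blast
  have "isCont F t" if t: "0 < t" for t
  proof -
    have "uniform_limit {t/2<..<2*t} (\<lambda>X u. \<Sum>i\<in>X. c i * gamma_kernel (b i) u) F (finite_subsets_at_top UNIV)"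
    proof (rule Weierstrass_m_test_general')
      \<comment> \<open>The constant factor is the worst case of the kernel bound over the interval:
        \<open>u < 2 * t\<close> in the exponential and \<open>u > t / 2\<close> in the
        denominator.\<close>
      show "(\<lambda>i. norm (c i * Z powr - b i) * (2 * exp (2 * Z * (2 * t)) / (t / 2))) summable_on UNIV"
        by (intro summable_on_cmult_left s)
      fix i u assume u: "u \<in> {t/2<..<2*t}"
      then have u0: "0 < u" using t by auto
      have "gamma_kernel (b i) u \<le> 2 * exp (2 * Z * u) / u * Z powr - b i"
        by (rule gamma_kernel_le[OF b assms(2) u0])
      also have "\<dots> \<le> 2 * exp (2 * Z * (2 * t)) / (t / 2) * Z powr - b i"
        using u u0 t assms(2) by (intro mult_right_mono frac_le) auto
      finally have "\<bar>c i\<bar> * gamma_kernel (b i) u \<le> \<bar>c i\<bar> * (2 * exp (2 * Z * (2 * t)) / (t / 2) * Z powr - b i)"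
        by (rule mult_left_mono) simp
      then show "norm (c i * gamma_kernel (b i) u) \<le> norm (c i * Z powr - b i) * (2 * exp (2 * Z * (2 * t)) / (t / 2))"
        using gamma_kernel_nonneg[OF b] by (simp add: abs_mult mult_ac)
    qed (use F t in auto)
    moreover have "continuous_on {t/2<..<2*t} (\<lambda>u. \<Sum>i\<in>X. c i * gamma_kernel (b i) u)" for X
      unfolding gamma_kernel_def using t less_imp_neq[OF Gamma_real_pos[OF b], symmetric] by (intro continuous_intros) auto
    ultimately have "continuous_on {t/2<..<2*t} F"
      by (intro uniform_limit_theorem[where F="finite_subsets_at_top UNIV"]) auto
    then show ?thesis using t by (auto simp: continuous_on_eq_continuous_at)
  qed
  then show ?thesis by (auto simp: continuous_on_eq_continuous_at)
qed

text \<open>The kernels are non-negative, so the \<open>L1\<close> norm of a term is exactly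
  \<open>norm (c i) * z powr - b i\<close>, at most its value at \<open>Z\<close>; the absolute
  convergence at \<open>Z\<close> is thus what termwise integration asks for.\<close>

lemma gamma_series_laplace:
  assumes "gamma_series Z F l" "0 < Z" "Z \<le> z"
  shows "has_bochner_integral lborel (\<lambda>t. indicator {0<..} t * (F t * exp (- (z * t)))) (l z)"
proof -
  obtain c :: "nat \<Rightarrow> real" and b where b: "\<And>i. 0 < b i"
    and s: "(\<lambda>i. c i * Z powr - b i) norm_summable_on UNIV"
    and F: "\<And>t. 0 < t \<Longrightarrow> ((\<lambda>i. c i * gamma_kernel (b i) t) has_sum F t) UNIV"
    and l: "((\<lambda>i. c i * z powr - b i) has_sum l z) UNIV"
    using assms unfolding gamma_series_def by blast
  have z: "0 < z" using assms by simp
  let ?f = "\<lambda>i t. indicator {0<..} t * (c i * gamma_kernel (b i) t * exp (- (z * t)))"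
  have I: "has_bochner_integral lborel (?f i) (c i * z powr - b i)" for i
    using has_bochner_integral_mult_right[OF has_bochner_integral_gamma_kernel_exp[OF b[of i] z], of "c i"]
    by (simp add: mult_ac)
  have "has_bochner_integral lborel (\<lambda>t. norm (c i) * (indicator {0<..} t * (gamma_kernel (b i) t * exp (- (z * t))))) (norm (c i) * z powr - b i)" for i
    using has_bochner_integral_mult_right[OF has_bochner_integral_gamma_kernel_exp[OF b[of i] z], of "norm (c i)"] by simp
  note I' = this
  have eq: "norm (?f i t) = norm (c i) * (indicator {0<..} t * (gamma_kernel (b i) t * exp (- (z * t))))" for i t
    using gamma_kernel_nonneg[OF b] by (simp add: abs_mult indicator_def)
  have N: "(\<integral>t. norm (?f i t) \<partial>lborel) = norm (c i) * z powr - b i" for i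
    unfolding eq by (rule has_bochner_integral_integral_eq[OF I'])
  have S1: "AE t in lborel. summable (\<lambda>i. norm (?f i t))"
  proof (rule AE_I2)
    fix t :: real
    show "summable (\<lambda>i. norm (?f i t))"
    proof (cases "0 < t")
      case True
      have "summable (\<lambda>i. norm (c i * gamma_kernel (b i) t))"
        using norm_summable_on_gamma_kernel[OF s assms(2) b True] by (simp add: summable_on_UNIV_nonneg_real_iff)
      then have "summable (\<lambda>i. norm (c i * gamma_kernel (b i) t) * exp (- (z * t)))" by (rule summable_mult2)
      then show ?thesis using True by (simp add: abs_mult)
    qed auto
  qed
  have S2: "summable (\<lambda>i. \<integral>t. norm (?f i t) \<partial>lborel)"
  proof (rule summable_comparison_test')
    show "summable (\<lambda>i. norm (c i * Z powr - b i))"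
      using s by (simp add: summable_on_UNIV_nonneg_real_iff)
    have "z powr - b i \<le> Z powr - b i" for i
      using assms(2,3) z b[of i] by (auto simp: powr_minus powr_mono2 intro!: le_imp_inverse_le)
    then show "norm (\<integral>t. norm (?f i t) \<partial>lborel) \<le> norm (c i * Z powr - b i)" for i
      unfolding N by (auto simp: abs_mult intro!: mult_left_mono)
  qed
  have eq: "(\<Sum>i. ?f i t) = indicator {0<..} t * (F t * exp (- (z * t)))" for t
  proof (cases "0 < t")
    case True
    have "(\<lambda>i. c i * gamma_kernel (b i) t * exp (- (z * t))) sums (F t * exp (- (z * t)))"
      using has_sum_imp_sums[OF F[OF True]] by (rule sums_mult2)
    then show ?thesis using True by (simp add: sums_iff)
  qed simp
  have int: "integrable lborel (?f i)" for i using I by (rule integrable.intros)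
  have "integrable lborel (\<lambda>t. \<Sum>i. ?f i t)" by (rule integrable_suminf[OF int S1 S2])
  moreover have "(\<lambda>i. \<integral>t. ?f i t \<partial>lborel) sums (\<integral>t. (\<Sum>i. ?f i t) \<partial>lborel)" by (rule sums_integral[OF int S1 S2])
  ultimately show ?thesis
    unfolding eq has_bochner_integral_integral_eq[OF I] has_bochner_integral_iff
    using has_sum_imp_sums[OF l] sums_unique2 by blast
qed

text \<open>The convolution is integrated termwise over pairs of indices. Each pair contributes a
  kernel of index \<open>b i + e j\<close>, and because kernels are non-negative the integrals of
  the absolute values are the absolute values of these terms, summable since the product family
  converges absolutely at \<open>Z\<close>.\<close>

lemma gamma_series_convolution:
  assumes "gamma_series Z F l" "gamma_series Z G k" and Z: "0 < Z"
  shows "gamma_series Z (convolution_half_line F G) (\<lambda>z. l z * k z)"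
proof -
  obtain c :: "nat \<Rightarrow> real" and b where b: "\<And>i. 0 < b i"
    and s: "(\<lambda>i. c i * Z powr - b i) norm_summable_on UNIV"
    and F: "\<And>t. 0 < t \<Longrightarrow> ((\<lambda>i. c i * gamma_kernel (b i) t) has_sum F t) UNIV"
    and l: "\<And>z. Z \<le> z \<Longrightarrow> ((\<lambda>i. c i * z powr - b i) has_sum l z) UNIV"
    using assms unfolding gamma_series_def by blast
  obtain d :: "nat \<Rightarrow> real" and e where e: "\<And>i. 0 < e i"
    and s': "(\<lambda>i. d i * Z powr - e i) norm_summable_on UNIV"
    and G: "\<And>t. 0 < t \<Longrightarrow> ((\<lambda>i. d i * gamma_kernel (e i) t) has_sum G t) UNIV"
    and k: "\<And>z. Z \<le> z \<Longrightarrow> ((\<lambda>i. d i * z powr - e i) has_sum k z) UNIV"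
    using assms unfolding gamma_series_def by blast
  have abs_mono: "(\<lambda>i. c i * z powr - b i) norm_summable_on UNIV"
    if "(\<lambda>i. c i * Z powr - b i) norm_summable_on UNIV" "\<And>i. 0 < b i" "Z \<le> z" for c b :: "nat \<Rightarrow> real" and z
  proof (rule summable_on_comparison_test[OF that(1)])
    have "z powr - b i \<le> Z powr - b i" for i
      using Z that(3) that(2)[of i] by (auto simp: powr_minus powr_mono2 intro!: le_imp_inverse_le)
    then show "norm (c i * z powr - b i) \<le> norm (c i * Z powr - b i)" for i
      by (auto simp: abs_mult intro!: mult_left_mono)
  qed auto
  let ?c = "\<lambda>(i, j). c i * d j" and ?b = "\<lambda>(i, j). b i + e j"
  have L: "((\<lambda>p. ?c p * z powr - ?b p) has_sum l z * k z) UNIV \<and> (\<lambda>p. ?c p * z powr - ?b p) norm_summable_on UNIV"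
    if "Z \<le> z" for z
    using has_sum_prod_times[OF abs_mono[OF s b that] l[OF that] abs_mono[OF s' e that] k[OF that]]
    by (simp add: case_prod_unfold powr_add powr_diff powr_minus field_simps)
  have P: "0 < ?b p" for p using b e by (auto simp: case_prod_unfold add_pos_pos)
  show ?thesis
  proof (rule gamma_seriesI[of ?b ?c])
    fix t :: real assume t: "0 < t"
    have abs: "(\<lambda>p. ?c p * gamma_kernel (?b p) t) norm_summable_on UNIV"
      by (rule norm_summable_on_gamma_kernel) (use L P Z t in auto)
    let ?f = "\<lambda>n u. indicator {0<..<t} u *
      (case prod_decode n of (i, j) \<Rightarrow> c i * d j * (gamma_kernel (b i) (t - u) * gamma_kernel (e j) u))"
    let ?s = "\<lambda>n. (case prod_decode n of (i, j) \<Rightarrow> c i * d j * gamma_kernel (b i + e j) t)"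
    have I: "has_bochner_integral lborel (?f n) (?s n)" for n
      using has_bochner_integral_mult_right[OF has_bochner_integral_gamma_kernel_conv[OF b e t],
          of "c (fst (prod_decode n)) * d (snd (prod_decode n))" "fst (prod_decode n)" "snd (prod_decode n)"]
      by (simp add: case_prod_unfold mult_ac)
    have "has_bochner_integral lborel (\<lambda>u. norm (?f n u)) (norm (?s n))" for n
      using has_bochner_integral_mult_right[OF has_bochner_integral_gamma_kernel_conv[OF b e t],
          of "norm (c (fst (prod_decode n)) * d (snd (prod_decode n)))" "fst (prod_decode n)" "snd (prod_decode n)"]
      using gamma_kernel_nonneg[OF b] gamma_kernel_nonneg[OF e] gamma_kernel_nonneg[OF add_pos_pos[OF b e]]
      by (simp add: case_prod_unfold abs_mult mult_ac)
    then have N: "(\<integral>u. norm (?f n u) \<partial>lborel) = norm (?s n)" for n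
      by (rule has_bochner_integral_integral_eq)
    have S2: "summable (\<lambda>n. \<integral>u. norm (?f n u) \<partial>lborel)"
      unfolding N using abs summable_on_reindex_bij_betw[OF bij_prod_decode, of "\<lambda>p. norm (?c p * gamma_kernel (?b p) t)"]
      by (simp add: case_prod_unfold summable_on_UNIV_nonneg_real_iff)
    have pt: "((\<lambda>(i, j). (c i * gamma_kernel (b i) (t - u)) * (d j * gamma_kernel (e j) u)) has_sum F (t - u) * G u) UNIV"
      "(\<lambda>(i, j). (c i * gamma_kernel (b i) (t - u)) * (d j * gamma_kernel (e j) u)) norm_summable_on UNIV"
      if "0 < u" "u < t" for u
      using has_sum_prod_times[OF norm_summable_on_gamma_kernel[OF s Z b] F norm_summable_on_gamma_kernel[OF s' Z e] G, of "t - u" u] that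
      by auto
    have S1: "AE u in lborel. summable (\<lambda>n. norm (?f n u))"
    proof (rule AE_I2)
      fix u :: real
      show "summable (\<lambda>n. norm (?f n u))"
      proof (cases "0 < u \<and> u < t")
        case True
        then have "summable (\<lambda>n. norm (case prod_decode n of (i, j) \<Rightarrow> (c i * gamma_kernel (b i) (t - u)) * (d j * gamma_kernel (e j) u)))"
          using pt(2)[of u] summable_on_reindex_bij_betw[OF bij_prod_decode, of "\<lambda>p. norm (case p of (i, j) \<Rightarrow> (c i * gamma_kernel (b i) (t - u)) * (d j * gamma_kernel (e j) u))"]
          by (simp add: summable_on_UNIV_nonneg_real_iff)
        then show ?thesis using True by (simp add: case_prod_unfold mult_ac)
      next
        case False then have "u \<notin> {0<..<t}" by auto
        then show ?thesis by simp
      qed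
    qed
    have eq: "(\<Sum>n. ?f n u) = indicator {0<..<t} u * (F (t - u) * G u)" for u
    proof (cases "0 < u \<and> u < t")
      case True
      then have "(\<lambda>n. case prod_decode n of (i, j) \<Rightarrow> (c i * gamma_kernel (b i) (t - u)) * (d j * gamma_kernel (e j) u)) sums (F (t - u) * G u)"
        using pt(1)[of u] has_sum_reindex_bij_betw[OF bij_prod_decode, of "\<lambda>(i, j). (c i * gamma_kernel (b i) (t - u)) * (d j * gamma_kernel (e j) u)"]
        by (intro has_sum_imp_sums) auto
      then show ?thesis using True by (simp add: case_prod_unfold mult_ac sums_iff)
    next
      case False then have "u \<notin> {0<..<t}" by auto
      then show ?thesis by simp
    qed
    have int: "integrable lborel (?f n)" for n using I by (rule integrable.intros)
    have "(\<lambda>n. \<integral>u. ?f n u \<partial>lborel) sums (\<integral>u. (\<Sum>n. ?f n u) \<partial>lborel)" by (rule sums_integral[OF int S1 S2])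
    then have "?s sums convolution_half_line F G t"
      unfolding has_bochner_integral_integral_eq[OF I] eq
      by (simp add: convolution_half_line_def set_lebesgue_integral_def)
    then have "(?s has_sum convolution_half_line F G t) UNIV"
      using S2 unfolding N by (intro norm_summable_imp_has_sum)
    then show "((\<lambda>p. ?c p * gamma_kernel (?b p) t) has_sum convolution_half_line F G t) UNIV"
      using has_sum_reindex_bij_betw[OF bij_prod_decode, of "\<lambda>p. ?c p * gamma_kernel (?b p) t"]
      by (simp add: case_prod_unfold)
  qed (use L P in auto)
qed

lemma gamma_series_convolution_power:
  assumes "gamma_series Z F l" "0 < Z" "1 \<le> N"
  shows "gamma_series Z (convolution_power N F) (\<lambda>z. l z ^ N)"
  using assms(3)
proof (induction N rule: nat_induct_at_least)
  case base
  then show ?case using assms(1) by (simp add: convolution_power_def)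
next
  case (Suc n)
  then obtain m where m: "n = Suc m" by (cases n) auto
  show ?case using gamma_series_convolution[OF assms(1) Suc.IH assms(2)]
    by (simp add: convolution_power_def m)
qed


text \<open>Since \<open>Gamma (h + 1 + r) / (fact r * Gamma (h + 1))\<close> is the binomial
  coefficient of \<open>h + r\<close> over \<open>r\<close>, and the power of \<open>t\<close> in
  the term \<open>(h, r)\<close> has exponent one less than the Gamma argument in its denominator,
  the expansion is a double family of kernels. Its transform is a double geometric series with
  ratios \<open>- p * z powr - d\<close> and \<open>- q * z powr - a\<close>, whose smallness at
  \<open>Z\<close> persists for larger \<open>z\<close>.\<close>

lemma gamma_series_mittag_leffler:
  fixes a d \<delta> p q Z :: real
  assumes "0 < a" "0 \<le> d" "0 < \<delta>" "0 \<le> p" "0 \<le> q" "0 < Z" and small: "p * Z powr - d + q * Z powr - a < 1"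
  shows "gamma_series Z
    (\<lambda>t. t powr (a + \<delta> - 1) * (\<Sum>h. (- p) ^ h * t powr (d * real h) *
        mittag_leffler3 a (a + d * real h + \<delta>) (real h + 1) (- q * t powr a)))
    (\<lambda>z. z powr - (a + \<delta>) / (1 + p * z powr - d + q * z powr - a))"
    (is "gamma_series Z ?F ?l")
proof -
  define b where "b = (\<lambda>(h, r). a + \<delta> + d * real h + a * real r)"
  define c where "c = (\<lambda>(h, r). real (h + r choose r) * ((- p) ^ h * (- q) ^ r))"
  have b: "0 < b x" for x using assms by (auto simp: b_def case_prod_unfold intro!: add_pos_nonneg)
  have L: "((\<lambda>x. c x * z powr - b x) has_sum ?l z) UNIV \<and> (\<lambda>x. c x * z powr - b x) norm_summable_on UNIV"
    if z: "Z \<le> z" for z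
  proof -
    have z0: "0 < z" using z assms by simp
    have mono: "z powr - e \<le> Z powr - e" if "0 \<le> e" for e
      using assms(6) z z0 that by (auto simp: powr_minus powr_mono2 intro!: le_imp_inverse_le)
    have "p * z powr - d + q * z powr - a \<le> p * Z powr - d + q * Z powr - a"
      using mono assms by (intro add_mono mult_left_mono) auto
    then have "\<bar>- (p * z powr - d)\<bar> + \<bar>- (q * z powr - a)\<bar> < 1" using small assms by simp
    note * = has_sum_binomial_geometric[OF this]
    have "c x * z powr - b x = z powr - (a + \<delta>) *
        (case x of (h, r) \<Rightarrow> real (h + r choose r) * ((- (p * z powr - d)) ^ h * (- (q * z powr - a)) ^ r))" for x
    proof -
      obtain h r where x: "x = (h, r)" by (cases x)
      have "z powr - b x = z powr - (a + \<delta>) * (z powr - d) ^ h * (z powr - a) ^ r"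
        using z0 by (simp add: x b_def powr_power powr_add[symmetric] algebra_simps)
      then show ?thesis unfolding x c_def
        by (simp add: power_mult_distrib[of "- p" "z powr - d", simplified] power_mult_distrib[of "- q" "z powr - a", simplified])
    qed
    moreover have eq: "1 - (- (p * z powr - d) + - (q * z powr - a)) = 1 + p * z powr - d + q * z powr - a" by simp
    ultimately show ?thesis
      using has_sum_cmult_right[OF *(1)[unfolded eq], of "z powr - (a + \<delta>)"] summable_on_cmult_right[OF *(2), of "z powr - (a + \<delta>)"]
      by (simp add: abs_mult)
  qed
  show ?thesis
  proof (rule gamma_seriesI[of b c])
    fix t :: real assume t: "0 < t"
    have "(\<lambda>x. c x * gamma_kernel (b x) t) norm_summable_on UNIV"
      using L[of Z] by (intro norm_summable_on_gamma_kernel[OF _ assms(6) b t]) auto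
    then have summ: "(\<lambda>x. c x * gamma_kernel (b x) t) summable_on UNIV"
      by (rule abs_summable_summable)
    define g where "g h = (\<Sum>\<^sub>\<infinity>r. c (h, r) * gamma_kernel (b (h, r)) t)" for h
    have g: "((\<lambda>r. c (h, r) * gamma_kernel (b (h, r)) t) has_sum g h) UNIV" for h
      unfolding g_def by (rule has_sum_infsum)
        (use summable_on_SigmaD1[of "\<lambda>h r. c (h, r) * gamma_kernel (b (h, r)) t" UNIV "\<lambda>_. UNIV" h] summ in \<open>auto simp: case_prod_unfold\<close>)
    have geq: "g h = t powr (a + \<delta> - 1) * ((- p) ^ h * t powr (d * real h) *
        mittag_leffler3 a (a + d * real h + \<delta>) (real h + 1) (- q * t powr a))" for h
    proof -
      let ?w = "t powr (a + \<delta> - 1) * ((- p) ^ h * t powr (d * real h))"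
      let ?m = "\<lambda>r. Gamma (real h + 1 + real r) * (- q * t powr a) ^ r /
          (fact r * Gamma (real h + 1) * Gamma (a * real r + (a + d * real h + \<delta>)))"
      have "c (h, r) * gamma_kernel (b (h, r)) t = ?w * ?m r" for r
      proof -
        have "real h + 1 + real r = 1 + real (h + r)" "real h + 1 = 1 + real h" by auto
        then have 1: "Gamma (real h + 1 + real r) = fact (h + r)" "Gamma (real h + 1) = fact h"
          by (simp_all only: Gamma_fact)
        have 2: "real (h + r choose r) = fact (h + r) / (fact r * fact h)" by (simp add: binomial_fact)
        have 3: "b (h, r) = a * real r + (a + d * real h + \<delta>)" by (simp add: b_def)
        have 4: "t powr (b (h, r) - 1) = t powr (a + \<delta> - 1) * t powr (d * real h) * (t powr a) ^ r"
          using t by (simp add: b_def powr_power powr_add[symmetric] algebra_simps)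
        show ?thesis unfolding gamma_kernel_def 4 unfolding 1 3 c_def prod.case 2
          by (simp add: power_mult_distrib[of "- q" "t powr a", simplified])
      qed
      then have s: "(\<lambda>r. ?w * ?m r) sums g h" using has_sum_imp_sums[OF g, of h] by simp
      show ?thesis
      \<comment> \<open>If \<open>p = 0\<close>, the weight of every \<open>h > 0\<close> vanishes
        and summability of the unweighted series cannot be read off from the weighted one; both
        sides are then zero. For \<open>h = 0\<close> the convention \<open>0 ^ 0 = 1\<close> keeps
        the weight nonzero.\<close>
      proof (cases "p = 0 \<and> h > 0")
        case True
        then have w: "?w = 0" by simp
        then have "g h = 0" using s by (simp only: mult_zero_left sums_iff suminf_zero)
        then show ?thesis using w by (simp only: mult.assoc[symmetric] mult_zero_left)
      next
        case False
        then have w: "?w \<noteq> 0" using t by auto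
        have "summable ?m" using s w by (simp only: sums_iff summable_cmult_iff) auto
        then have "(\<lambda>r. ?w * ?m r) sums (?w * suminf ?m)" by (intro sums_mult summable_sums)
        with s have "g h = ?w * suminf ?m" by (rule sums_unique2)
        then show ?thesis unfolding mittag_leffler3_def by (simp only: mult.assoc)
      qed
    qed
    have "(g has_sum infsum (\<lambda>x. c x * gamma_kernel (b x) t) UNIV) UNIV"
      using has_sum_SigmaD[where f="\<lambda>x. c x * gamma_kernel (b x) t" and A=UNIV and B="\<lambda>_. UNIV" and g=g]
        has_sum_infsum[OF summ] g by simp
    then have s: "g sums infsum (\<lambda>x. c x * gamma_kernel (b x) t) UNIV" by (rule has_sum_imp_sums)
    have t0: "t powr (a + \<delta> - 1) \<noteq> 0" using t by simp
    have "infsum (\<lambda>x. c x * gamma_kernel (b x) t) UNIV = ?F t"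
      using s t0 unfolding geq[abs_def] by (simp only: sums_iff summable_cmult_iff) (auto simp: suminf_mult)
    then show "((\<lambda>x. c x * gamma_kernel (b x) t) has_sum ?F t) UNIV"
      using has_sum_infsum[OF summ] by simp
  qed (use L b in auto)
qed

section \<open>Uniqueness of Laplace transforms\<close>

text \<open>The transform at \<open>Z + n\<close> is a moment in the variable \<open>exp (- u)\<close>, so by Weierstrass approximation
  \<open>H\<close> integrates to zero against a bump function supported just to the right of \<open>t\<close>.\<close>

lemma laplace_zero_imp_nonpos:
  fixes H :: "real \<Rightarrow> real"
  assumes I: "\<And>z. Z \<le> z \<Longrightarrow> has_bochner_integral lborel (\<lambda>t. indicator {0<..} t * (H t * exp (- (z * t)))) 0"
    and t: "0 < t" and rc: "(H \<longlongrightarrow> H t) (at_right t)"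
  shows "H t \<le> 0"
proof (rule ccontr)
  assume "\<not> H t \<le> 0"
  then have "\<forall>\<^sub>F u in at_right t. 0 < H u" using rc by (intro order_tendstoD) auto
  then obtain s where s: "t < s" "\<And>u. t < u \<Longrightarrow> u < s \<Longrightarrow> 0 < H u"
    by (auto simp: eventually_at_right[of t "t + 1"])
  define w where "w u = indicator {0<..} u * (H u * exp (- (Z * u)))" for u
  \<comment> \<open>In the variable \<open>x = exp (- u)\<close> the interval
    \<open>t < u < s\<close> becomes \<open>exp (- s) < x < exp (- t)\<close>, exactly where the
    quadratic is positive; cutting it off at \<open>0\<close> keeps it continuous on
    \<open>[0, 1]\<close>.\<close>
  define q where "q x = max 0 ((x - exp (- s)) * (exp (- t) - x))" for x :: real
  have w: "integrable lborel w" using I[of Z] unfolding w_def by (auto dest: integrable.intros)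
  then have [measurable]: "w \<in> borel_measurable borel" by auto
  have qc: "continuous_on A q" for A unfolding q_def by (intro continuous_intros)
  then have [measurable]: "q \<in> borel_measurable borel" by (intro borel_measurable_continuous_onI)
  have pow: "has_bochner_integral lborel (\<lambda>u. w u * exp (- u) ^ n) 0" for n
  proof -
    have "w u * exp (- u) ^ n = indicator {0<..} u * (H u * exp (- ((Z + real n) * u)))" for u
      by (simp add: w_def exp_of_nat_mult[symmetric] exp_add[symmetric] algebra_simps)
    then show ?thesis using I[of "Z + real n"] by simp
  qed
  have wq: "integrable lborel (\<lambda>u. w u * f (exp (- u)))" if [measurable]: "f \<in> borel_measurable borel"
    and "\<And>x. 0 \<le> x \<Longrightarrow> x \<le> 1 \<Longrightarrow> \<bar>f x\<bar> \<le> C" for f :: "real \<Rightarrow> real" and C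
  proof (rule Bochner_Integration.integrable_bound)
    show "integrable lborel (\<lambda>u. C * w u)" using w by simp
    have "\<bar>w u\<bar> * \<bar>f (exp (- u))\<bar> \<le> \<bar>w u\<bar> * \<bar>C\<bar>" if "0 \<le> u" for u
      using that(1) by (intro mult_left_mono order_trans[OF \<open>\<And>x. 0 \<le> x \<Longrightarrow> x \<le> 1 \<Longrightarrow> \<bar>f x\<bar> \<le> C\<close>]) auto
    moreover have "w u = 0" if "\<not> 0 \<le> u" for u using that by (simp add: w_def)
    ultimately show "AE u in lborel. norm (w u * f (exp (- u))) \<le> norm (C * w u)"
      by (intro AE_I2) (metis abs_mult mult.commute mult_zero_left mult_zero_right order_refl real_norm_def)
  qed measurable
  have "norm (\<integral>u. w u * q (exp (- u)) \<partial>lborel) \<le> e * (\<integral>u. norm (w u) \<partial>lborel)" if e: "0 < e" for e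
  proof -
    obtain g where g: "real_polynomial_function g" "\<And>x. x \<in> {0..1} \<Longrightarrow> \<bar>q x - g x\<bar> < e"
      using Stone_Weierstrass_real_polynomial_function[OF compact_Icc qc e] by metis
    obtain a n where gs: "g = (\<lambda>x. \<Sum>i\<le>n. a i * x ^ i)"
      using g(1) unfolding real_polynomial_function_iff_sum by blast
    have [measurable]: "g \<in> borel_measurable borel" unfolding gs by measurable
    have "has_bochner_integral lborel (\<lambda>u. \<Sum>i\<le>n. a i * (w u * exp (- u) ^ i)) (\<Sum>i\<le>n. a i * 0)"
      by (intro has_bochner_integral_sum has_bochner_integral_mult_right pow)
    then have G: "has_bochner_integral lborel (\<lambda>u. w u * g (exp (- u))) 0"
      by (simp add: gs sum_distrib_left mult_ac)
    have D: "integrable lborel (\<lambda>u. w u * (q (exp (- u)) - g (exp (- u))))"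
      using g(2) by (intro wq[of "\<lambda>x. q x - g x" e]) (auto intro: less_imp_le)
    have "(\<integral>u. w u * q (exp (- u)) \<partial>lborel)
      = (\<integral>u. w u * (q (exp (- u)) - g (exp (- u))) + w u * g (exp (- u)) \<partial>lborel)"
      by (simp add: algebra_simps)
    also have "\<dots> = (\<integral>u. w u * (q (exp (- u)) - g (exp (- u))) \<partial>lborel)"
      using D G by (subst Bochner_Integration.integral_add) (auto simp: has_bochner_integral_iff)
    finally have "norm (\<integral>u. w u * q (exp (- u)) \<partial>lborel) \<le> (\<integral>u. norm (w u * (q (exp (- u)) - g (exp (- u)))) \<partial>lborel)"
      using integral_norm_bound by metis
    also have "\<dots> \<le> (\<integral>u. e * norm (w u) \<partial>lborel)"
    proof (rule integral_mono)
      show "norm (w u * (q (exp (- u)) - g (exp (- u)))) \<le> e * norm (w u)" for u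
      proof (cases "0 < u")
        case True
        then have "\<bar>w u\<bar> * \<bar>q (exp (- u)) - g (exp (- u))\<bar> \<le> \<bar>w u\<bar> * e"
          using g(2)[of "exp (- u)"] by (intro mult_left_mono) auto
        then show ?thesis by (simp add: abs_mult mult.commute)
      qed (simp add: w_def)
    qed (use D w in auto)
    finally show ?thesis by simp
  qed
  note small = this
  have "norm (\<integral>u. w u * q (exp (- u)) \<partial>lborel) \<le> 0"
  proof (rule field_le_epsilon)
    fix e :: real assume e: "0 < e"
    let ?W = "\<integral>u. norm (w u) \<partial>lborel"
    have W: "0 \<le> ?W" by simp
    have "norm (\<integral>u. w u * q (exp (- u)) \<partial>lborel) \<le> e / (?W + 1) * ?W"
      using e W by (intro small divide_pos_pos add_nonneg_pos) auto
    also have "\<dots> \<le> e"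
    proof -
      have "e / (x + 1) * x \<le> e" if "0 \<le> x" for x using e that by (simp add: field_simps)
      then show ?thesis using W .
    qed
    finally show "norm (\<integral>u. w u * q (exp (- u)) \<partial>lborel) \<le> 0 + e" by simp
  qed
  then have zero: "(\<integral>u. w u * q (exp (- u)) \<partial>lborel) = 0" by simp
  have pos: "0 < w u * q (exp (- u))" if "t < u" "u < s" for u
    using that s t by (auto simp: w_def q_def less_max_iff_disj)
  have nz: "w u * q (exp (- u)) = 0" if "\<not> (t < u \<and> u < s)" for u
  proof -
    have "(exp (- u) - exp (- s)) * (exp (- t) - exp (- u)) \<le> 0"
    proof (cases "u \<le> t")
      case True
      then show ?thesis using s(1) by (intro mult_nonneg_nonpos) auto
    next
      case False
      then show ?thesis using that by (intro mult_nonpos_nonneg) auto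
    qed
    then show ?thesis by (simp add: q_def)
  qed
  have "\<bar>q x\<bar> \<le> 1" if "0 \<le> x" "x \<le> 1" for x
  proof -
    have "(x - exp (- s)) * (exp (- t) - x) \<le> \<bar>x - exp (- s)\<bar> * \<bar>exp (- t) - x\<bar>"
      by (metis abs_ge_self abs_mult)
    also have "\<dots> \<le> 1 * 1"
    proof (rule mult_mono)
      have "0 < exp (- s)" "exp (- s) \<le> 1" "0 < exp (- t)" "exp (- t) \<le> 1" using s t by auto
      then show "\<bar>x - exp (- s)\<bar> \<le> 1" "\<bar>exp (- t) - x\<bar> \<le> 1" using that by linarith+
    qed auto
    finally show ?thesis by (simp add: q_def)
  qed
  then have int: "integrable lborel (\<lambda>u. w u * q (exp (- u)))" by (intro wq) auto
  have "0 \<le> w u * q (exp (- u))" for u using pos[of u] nz[of u] by fastforce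
  then have "AE u in lborel. w u * q (exp (- u)) = 0"
    using zero integral_nonneg_eq_0_iff_AE[OF int] by simp
  then have "AE u in lborel. u \<notin> {t<..<s}"
    by eventually_elim (use pos in force)
  then have "emeasure lborel {t<..<s} = 0" by (subst (asm) AE_iff_measurable[of "{t<..<s}"]) auto
  then show False using s(1) by simp
qed

text \<open>The one-sided statement is applied to both differences. Right-continuity is the natural
  requirement here because the paths of an inverse subordinator obtain it directly from the
  infimum.\<close>

lemma laplace_unique_right_continuous:
  fixes F G :: "real \<Rightarrow> real"
  assumes F: "\<And>z. Z \<le> z \<Longrightarrow> has_bochner_integral lborel (\<lambda>t. indicator {0<..} t * (F t * exp (- (z * t)))) (l z)"
    and G: "\<And>z. Z \<le> z \<Longrightarrow> has_bochner_integral lborel (\<lambda>t. indicator {0<..} t * (G t * exp (- (z * t)))) (l z)"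
    and t: "0 < t" and rc: "(F \<longlongrightarrow> F t) (at_right t)" "(G \<longlongrightarrow> G t) (at_right t)"
  shows "F t = G t"
proof (rule antisym)
  have "F t - G t \<le> 0"
    using t rc
  proof (intro laplace_zero_imp_nonpos[of Z "\<lambda>t. F t - G t"] tendsto_diff)
    fix z assume "Z \<le> z"
    from has_bochner_integral_diff[OF F[OF this] G[OF this]]
    show "has_bochner_integral lborel (\<lambda>t. indicator {0<..} t * ((F t - G t) * exp (- (z * t)))) 0"
      by (simp add: algebra_simps)
  qed
  then show "F t \<le> G t" by simp
  have "G t - F t \<le> 0"
    using t rc
  proof (intro laplace_zero_imp_nonpos[of Z "\<lambda>t. G t - F t"] tendsto_diff)
    fix z assume "Z \<le> z"
    from has_bochner_integral_diff[OF G[OF this] F[OF this]]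
    show "has_bochner_integral lborel (\<lambda>t. indicator {0<..} t * ((G t - F t) * exp (- (z * t)))) 0"
      by (simp add: algebra_simps)
  qed
  then show "G t \<le> F t" by simp
qed

section \<open>The Erlang queue\<close>

lemma tendsto_abs_at_right_0: "filterlim (\<lambda>h::real. \<bar>h\<bar>) (at_right 0) (at 0)"
  by (auto simp: filterlim_at eventually_at_filter intro!: tendsto_eq_intros)

context
  fixes S :: "'s set" and P :: "real \<Rightarrow> 's \<Rightarrow> 's \<Rightarrow> real"
  assumes P: "transition_function S P"
begin

lemma transition_function_nonneg: "0 \<le> t \<Longrightarrow> i \<in> S \<Longrightarrow> j \<in> S \<Longrightarrow> 0 \<le> P t i j"
  and transition_function_has_sum: "0 \<le> t \<Longrightarrow> i \<in> S \<Longrightarrow> (P t i has_sum 1) S"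
  and transition_function_0: "i \<in> S \<Longrightarrow> j \<in> S \<Longrightarrow> P 0 i j = (if i = j then 1 else 0)"
  and transition_function_Chapman_Kolmogorov:
    "0 \<le> s \<Longrightarrow> 0 \<le> t \<Longrightarrow> i \<in> S \<Longrightarrow> j \<in> S \<Longrightarrow> ((\<lambda>l. P s i l * P t l j) has_sum P (s + t) i j) S"
  using P unfolding transition_function_def by blast+

lemma transition_function_le_1:
  assumes "0 \<le> t" "i \<in> S" "j \<in> S"
  shows "P t i j \<le> 1"
proof -
  have "sum (P t i) {j} \<le> 1"
    using transition_function_has_sum[of t i] transition_function_nonneg[of t i] assms
    by (intro has_sum_mono2[OF has_sum_finite]) auto
  then show ?thesis by simp
qed

text \<open>Chapman-Kolmogorov is cut down to the finite set \<open>F\<close>: since entries are at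
  most one, the discarded terms are bounded by the mass that \<open>P h i\<close> puts outside
  \<open>F\<close>. This avoids limits under an infinite sum.\<close>

lemma transition_function_finite_approx:
  assumes h: "0 \<le> h" and s: "0 \<le> s" and ij: "i \<in> S" "j \<in> S" and F: "finite F" "F \<subseteq> S"
  shows "\<bar>P (h + s) i j - (\<Sum>l\<in>F. P h i l * P s l j)\<bar> \<le> 1 - (\<Sum>l\<in>F. P h i l)"
proof -
  have 1: "((\<lambda>l. P h i l * P s l j) has_sum P (h + s) i j - (\<Sum>l\<in>F. P h i l * P s l j)) (S - F)"
    using transition_function_Chapman_Kolmogorov[OF h s ij] F by (intro has_sum_Diff has_sum_finite) auto
  have 2: "(P h i has_sum 1 - (\<Sum>l\<in>F. P h i l)) (S - F)"
    using transition_function_has_sum[OF h ij(1)] F by (intro has_sum_Diff has_sum_finite) auto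
  have "0 \<le> P (h + s) i j - (\<Sum>l\<in>F. P h i l * P s l j)"
    using transition_function_nonneg assms by (intro has_sum_nonneg[OF 1] mult_nonneg_nonneg) auto
  moreover have "P (h + s) i j - (\<Sum>l\<in>F. P h i l * P s l j) \<le> 1 - (\<Sum>l\<in>F. P h i l)"
    using transition_function_nonneg transition_function_le_1 assms
    by (intro has_sum_mono[OF 1 2] mult_left_le) auto
  ultimately show ?thesis by simp
qed

text \<open>Two errors, each at most \<open>1 - P h i i\<close>: being elsewhere than
  \<open>i\<close> after time \<open>h\<close>, and replacing the factor \<open>P h i i\<close> by
  one. The bound is uniform in \<open>s\<close>, so with \<open>s = t - h\<close> it also controls
  the limit from the left at \<open>t\<close>.\<close>

lemma transition_function_uniform_continuity:
  assumes "0 \<le> h" "0 \<le> s" "i \<in> S" "j \<in> S"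
  shows "\<bar>P (h + s) i j - P s i j\<bar> \<le> 2 * (1 - P h i i)"
proof -
  have "\<bar>P (h + s) i j - P h i i * P s i j\<bar> \<le> 1 - P h i i"
    using transition_function_finite_approx[OF assms, of "{i}"] assms by simp
  moreover have "\<bar>P h i i * P s i j - P s i j\<bar> \<le> 1 - P h i i"
  proof -
    have "P h i i * P s i j - P s i j = - ((1 - P h i i) * P s i j)" by (simp add: algebra_simps)
    moreover have "(1 - P h i i) * P s i j \<le> 1 - P h i i"
      using transition_function_le_1 assms by (intro mult_left_le) auto
    moreover have "0 \<le> (1 - P h i i) * P s i j"
      using transition_function_le_1 transition_function_nonneg assms by auto
    ultimately show ?thesis by simp
  qed
  ultimately show ?thesis
    using abs_triangle_ineq[of "P (h + s) i j - P h i i * P s i j" "P h i i * P s i j - P s i j"] by simp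
qed

context
  fixes rate
  assumes deriv: "\<And>i j. i \<in> S \<Longrightarrow> j \<in> S \<Longrightarrow> ((\<lambda>t. P t i j) has_real_derivative q_matrix S rate i j) (at_right 0)"
begin

lemma transition_function_tendsto_0:
  assumes "i \<in> S" "j \<in> S"
  shows "((\<lambda>t. P t i j) \<longlongrightarrow> P 0 i j) (at_right 0)"
  using DERIV_continuous[OF deriv[OF assms]] by (simp add: continuous_within)

text \<open>A difference quotient with negative increment \<open>h\<close> is a forward quotient
  based at \<open>t + h\<close>. In either case the base point is \<open>min t (t + h)\<close>, and
  moving it must be harmless in the limit.\<close>

lemma transition_function_tendsto_min:
  assumes t: "0 < t" and ij: "i \<in> S" "j \<in> S"
  shows "((\<lambda>h. P (min t (t + h)) i j) \<longlongrightarrow> P t i j) (at 0)"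
proof -
  have "((\<lambda>h. P (min t (t + h)) i j - P t i j) \<longlongrightarrow> 0) (at 0)"
  proof (rule Lim_null_comparison)
    have "((\<lambda>h. 2 * (1 - P h i i)) \<longlongrightarrow> 2 * (1 - P 0 i i)) (at_right 0)"
      by (intro tendsto_intros transition_function_tendsto_0 ij)
    then have "((\<lambda>h. 2 * (1 - P h i i)) \<longlongrightarrow> 0) (at_right 0)" using ij by (simp add: transition_function_0)
    from filterlim_compose[OF this tendsto_abs_at_right_0]
    show "((\<lambda>h. 2 * (1 - P \<bar>h\<bar> i i)) \<longlongrightarrow> 0) (at 0)" .
    have "norm (P (min t (t + h)) i j - P t i j) \<le> 2 * (1 - P \<bar>h\<bar> i i)" if "dist h 0 < t" for h
    proof (cases "h \<le> 0")
      case True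
      then show ?thesis using transition_function_uniform_continuity[of "- h" "t + h" i j] transition_function_le_1[of 0 i i] that ij
        by (simp add: min_def abs_minus_commute)
    next
      case False
      then show ?thesis using transition_function_le_1[of h i i] ij by (simp add: min_def)
    qed
    then show "\<forall>\<^sub>F h in at 0. norm (P (min t (t + h)) i j - P t i j) \<le> 2 * (1 - P \<bar>h\<bar> i i)"
      using t unfolding eventually_at by blast
  qed
  then show ?thesis by (rule LIM_zero_cancel)
qed

text \<open>The row of the generator already sums to zero over \<open>F\<close>, so the probability
  of being outside \<open>F\<close> at time \<open>h\<close> is \<open>o(h)\<close> and the
  right-hand side is a finite sum. The error bound does not depend on the base point, and this turns
  the one-sided derivatives at \<open>0\<close> into a two-sided derivative at
  \<open>t\<close>.\<close>

lemma transition_function_backward_equation: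
  assumes t: "0 < t" and ij: "i \<in> S" "j \<in> S" and F: "finite F" "F \<subseteq> S" "i \<in> F"
    and conservative: "(\<Sum>l\<in>F. q_matrix S rate i l) = 0"
  shows "((\<lambda>t. P t i j) has_real_derivative (\<Sum>l\<in>F. q_matrix S rate i l * P t l j)) (at t)"
proof -
  define q where "q = q_matrix S rate i"
  define G where "G s = (\<Sum>l\<in>F. q l * P s l j)" for s
  \<comment> \<open>An error bound valid for every base point: the first summand is the mass outside
    \<open>F\<close> per unit time, the second the error of the difference quotients inside
    \<open>F\<close>. The first tends to \<open>- (\<Sum>l\<in>F. q l)\<close>, which is zero by
    \<open>conservative\<close>.\<close>
  define e where "e h = (1 - (\<Sum>l\<in>F. P h i l)) / h + (\<Sum>l\<in>F. \<bar>(P h i l - P 0 i l) / h - q l\<bar>)" for h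
  have quot: "((\<lambda>h. (P h i l - P 0 i l) / h) \<longlongrightarrow> q l) (at_right 0)" if "l \<in> F" for l
    using deriv[of i l] that F ij by (auto simp: has_field_derivative_iff q_def)
  have sum0: "(\<Sum>l\<in>F. P 0 i l) = 1"
  proof -
    have "(\<Sum>l\<in>F. P 0 i l) = (\<Sum>l\<in>F. if i = l then 1 else 0)"
      using F ij by (intro sum.cong) (auto simp: transition_function_0)
    then show ?thesis using F by simp
  qed
  have "((\<lambda>h. - (\<Sum>l\<in>F. (P h i l - P 0 i l) / h) + (\<Sum>l\<in>F. \<bar>(P h i l - P 0 i l) / h - q l\<bar>))
      \<longlongrightarrow> - (\<Sum>l\<in>F. q l) + (\<Sum>l\<in>F. \<bar>q l - q l\<bar>)) (at_right 0)"
    by (intro tendsto_intros quot)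
  moreover have "- (\<Sum>l\<in>F. (P h i l - P 0 i l) / h) + (\<Sum>l\<in>F. \<bar>(P h i l - P 0 i l) / h - q l\<bar>) = e h" for h
    by (simp add: e_def sum_divide_distrib[symmetric] sum_subtractf sum0 minus_divide_left)
  ultimately have e0: "(e \<longlongrightarrow> 0) (at_right 0)" using conservative by (simp add: q_def)
  have key: "\<bar>(P (h + s) i j - P s i j) / h - G s\<bar> \<le> e h" if h: "0 < h" and s: "0 \<le> s" for h s
  proof -
    have "P s i j = (\<Sum>l\<in>F. P 0 i l * P s l j)"
    proof -
      have "(\<Sum>l\<in>F. P 0 i l * P s l j) = (\<Sum>l\<in>F. if i = l then P s l j else 0)"
        using F ij by (intro sum.cong) (auto simp: transition_function_0)
      then show ?thesis using F by simp
    qed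
    then have eq: "(P (h + s) i j - P s i j) / h - G s
        = (P (h + s) i j - (\<Sum>l\<in>F. P h i l * P s l j)) / h
          + (\<Sum>l\<in>F. ((P h i l - P 0 i l) / h - q l) * P s l j)"
      by (simp add: G_def sum_divide_distrib diff_divide_distrib sum_subtractf left_diff_distrib)
    have "\<bar>(P (h + s) i j - (\<Sum>l\<in>F. P h i l * P s l j)) / h\<bar> \<le> (1 - (\<Sum>l\<in>F. P h i l)) / h"
      using transition_function_finite_approx[of h s i j F] h s ij F by (simp add: divide_right_mono)
    moreover have "\<bar>\<Sum>l\<in>F. ((P h i l - P 0 i l) / h - q l) * P s l j\<bar> \<le> (\<Sum>l\<in>F. \<bar>(P h i l - P 0 i l) / h - q l\<bar>)"
    proof (rule order_trans[OF sum_abs], rule sum_mono)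
      fix l assume "l \<in> F"
      then have "\<bar>P s l j\<bar> \<le> 1" using transition_function_nonneg[of s l j] transition_function_le_1[of s l j] s F ij by auto
      then show "\<bar>((P h i l - P 0 i l) / h - q l) * P s l j\<bar> \<le> \<bar>(P h i l - P 0 i l) / h - q l\<bar>"
        by (simp only: abs_mult) (simp add: mult_left_le)
    qed
    ultimately show ?thesis unfolding eq e_def by linarith
  qed
  have "((\<lambda>h. (P (t + h) i j - P t i j) / h - G t) \<longlongrightarrow> 0) (at 0)"
  proof (rule Lim_null_comparison)
    have "((\<lambda>h. e \<bar>h\<bar> + \<bar>G (min t (t + h)) - G t\<bar>) \<longlongrightarrow> 0 + \<bar>G t - G t\<bar>) (at 0)"
      unfolding G_def using F ij
      by (intro tendsto_intros filterlim_compose[OF e0 tendsto_abs_at_right_0] transition_function_tendsto_min t) auto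
    then show "((\<lambda>h. e \<bar>h\<bar> + \<bar>G (min t (t + h)) - G t\<bar>) \<longlongrightarrow> 0) (at 0)" by simp
    have "norm ((P (t + h) i j - P t i j) / h - G t) \<le> e \<bar>h\<bar> + \<bar>G (min t (t + h)) - G t\<bar>"
      if "h \<noteq> 0" "dist h 0 < t" for h
    proof (cases "0 < h")
      case True
      then show ?thesis using key[of h t] t by (simp add: min_def add.commute)
    next
      case False
      then have h: "h < 0" using that by simp
      \<comment> \<open>Forward increment \<open>- h\<close> from the base point
        \<open>t + h\<close>: the two sign changes leave the quotient as it was, while
        \<open>G\<close> is taken at \<open>t + h\<close>, which the second summand of the bound
        pays for.\<close>
      have "\<bar>(P (- h + (t + h)) i j - P (t + h) i j) / (- h) - G (t + h)\<bar> \<le> e (- h)"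
        using h that by (intro key) auto
      then have "\<bar>(P (t + h) i j - P t i j) / h - G (t + h)\<bar> \<le> e (- h)"
        by (simp add: minus_divide_left)
      then show ?thesis using h by (simp add: min_def)
    qed
    then show "\<forall>\<^sub>F h in at 0. norm ((P (t + h) i j - P t i j) / h - G t) \<le> e \<bar>h\<bar> + \<bar>G (min t (t + h)) - G t\<bar>"
      using t unfolding eventually_at by blast
  qed
  then show ?thesis unfolding DERIV_def G_def q_def by (rule LIM_zero_cancel)
qed

end

end

section \<open>Phase dynamics of the queue and Taylor coefficients\<close>

definition erlang_up :: "nat \<Rightarrow> nat \<times> nat \<Rightarrow> nat \<times> nat" where
  "erlang_up k i = (if fst i = 0 then (1, k) else (fst i + 1, snd i))"

text \<open>The empty system is sent to itself: adding a fictitious departure there makes the total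
  jump rate constant without changing the chain.\<close>

definition erlang_down :: "nat \<Rightarrow> nat \<times> nat \<Rightarrow> nat \<times> nat" where
  "erlang_down k i = (if fst i = 0 then i else if snd i \<ge> 2 then (fst i, snd i - 1)
     else if fst i \<ge> 2 then (fst i - 1, k) else (0, 0))"

text \<open>The number of service phases still to be completed: \<open>k\<close> for each waiting
  customer and \<open>s\<close> for the one in service. An arrival adds \<open>k\<close>, a
  completion removes one, and only the empty system has value zero, so emptiness becomes a question
  about a walk on the naturals.\<close>

definition erlang_phases :: "nat \<Rightarrow> nat \<times> nat \<Rightarrow> nat" where
  "erlang_phases k i = (if fst i = 0 then 0 else (fst i - 1) * k + snd i)"

lemma erlang_up_in: "1 \<le> k \<Longrightarrow> i \<in> erlang_states k \<Longrightarrow> erlang_up k i \<in> erlang_states k"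
  and erlang_down_in: "1 \<le> k \<Longrightarrow> i \<in> erlang_states k \<Longrightarrow> erlang_down k i \<in> erlang_states k"
  by (auto simp: erlang_states_def erlang_up_def erlang_down_def split: if_splits)

lemma erlang_phases_up: "i \<in> erlang_states k \<Longrightarrow> erlang_phases k (erlang_up k i) = erlang_phases k i + k"
proof -
  assume "i \<in> erlang_states k"
  then obtain n s where "i = (n, s)" "n = 0 \<and> s = 0 \<or> 1 \<le> n \<and> 1 \<le> s"
    by (auto simp: erlang_states_def)
  then show ?thesis by (cases n) (auto simp: erlang_phases_def erlang_up_def)
qed

lemma erlang_phases_down: "i \<in> erlang_states k \<Longrightarrow> erlang_phases k (erlang_down k i) = erlang_phases k i - 1"
proof -
  assume "i \<in> erlang_states k"
  then obtain n s where i: "i = (n, s)" "n = 0 \<and> s = 0 \<or> 1 \<le> n \<and> 1 \<le> s"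
    by (auto simp: erlang_states_def)
  then show ?thesis
    by (cases n; cases "n - 1") (auto simp: erlang_phases_def erlang_down_def)
qed

lemma erlang_phases_eq_0: "i \<in> erlang_states k \<Longrightarrow> erlang_phases k i = 0 \<longleftrightarrow> i = (0, 0)"
  by (auto simp: erlang_states_def erlang_phases_def)

text \<open>Stating the row as an action on an arbitrary \<open>g\<close> covers both uses: constant
  \<open>g\<close> gives the vanishing row sum, \<open>g l = P t l j\<close> the backward equation.
  In the empty state the fictitious departure contributes \<open>real k * mu * g i\<close> twice,
  with opposite signs.\<close>

lemma q_matrix_erlang:
  assumes "1 \<le> k" "i \<in> erlang_states k"
  shows "\<exists>F. finite F \<and> F \<subseteq> erlang_states k \<and> i \<in> F \<and>
    (\<forall>g. (\<Sum>l\<in>F. q_matrix (erlang_states k) (erlang_rate lam mu k) i l * g l) =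
      lam * g (erlang_up k i) + real k * mu * g (erlang_down k i) - (lam + real k * mu) * g i)"
proof -
  let ?S = "erlang_states k" and ?r = "erlang_rate lam mu k"
  let ?u = "erlang_up k i" and ?d = "erlang_down k i"
  have S: "?u \<in> ?S" "?d \<in> ?S" using assms erlang_up_in erlang_down_in by auto
  obtain n s where i: "i = (n, s)" "n = 0 \<and> s = 0 \<or> 1 \<le> n \<and> 1 \<le> s"
    using assms(2) by (auto simp: erlang_states_def)
  show ?thesis
  proof (cases "n = 0")
    case True
    have ne: "?u \<noteq> i" and d: "?d = i" and r: "?r i l = (if l = ?u then lam else 0)" for l
      using True i by (auto simp: erlang_up_def erlang_down_def)
    have "(\<Sum>\<^sub>\<infinity>l\<in>?S - {i}. ?r i l) = (\<Sum>\<^sub>\<infinity>l\<in>{?u}. ?r i l)"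
      using S ne by (intro infsum_cong_neutral) (auto simp: r)
    also have "\<dots> = lam" by (simp add: r)
    finally have q: "q_matrix ?S ?r i i = - lam" by (simp add: q_matrix_def)
    show ?thesis
      using S assms ne by (intro exI[of _ "{i, ?u}"]) (auto simp: q d, auto simp: q_matrix_def r algebra_simps)
  next
    case False
    have ne: "?u \<noteq> i" "?d \<noteq> i" "?u \<noteq> ?d" "?d \<noteq> ?u" and r: "?r i l = (if l = ?u then lam else if l = ?d then real k * mu else 0)" for l
      using False i by (auto simp: erlang_up_def erlang_down_def)
    have "(\<Sum>\<^sub>\<infinity>l\<in>?S - {i}. ?r i l) = (\<Sum>\<^sub>\<infinity>l\<in>{?u, ?d}. ?r i l)"
      using S ne by (intro infsum_cong_neutral) (auto simp: r)
    also have "\<dots> = lam + real k * mu" using ne by (simp add: r)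
    finally have q: "q_matrix ?S ?r i i = - (lam + real k * mu)" by (simp add: q_matrix_def)
    show ?thesis
      using S assms ne by (intro exI[of _ "{i, ?u, ?d}"]) (auto simp: q, auto simp: q_matrix_def r algebra_simps)
  qed
qed

lemma erlang_backward_equation:
  assumes k: "1 \<le> k" and P: "transition_function (erlang_states k) P"
    and deriv: "\<And>i j. i \<in> erlang_states k \<Longrightarrow> j \<in> erlang_states k \<Longrightarrow>
      ((\<lambda>t. P t i j) has_real_derivative q_matrix (erlang_states k) (erlang_rate lam mu k) i j) (at_right 0)"
    and t: "0 < t" and ij: "i \<in> erlang_states k" "j \<in> erlang_states k"
  shows "((\<lambda>t. P t i j) has_real_derivative
    lam * P t (erlang_up k i) j + real k * mu * P t (erlang_down k i) j - (lam + real k * mu) * P t i j) (at t)"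
proof -
  obtain F where F: "finite F" "F \<subseteq> erlang_states k" "i \<in> F" and eq:
    "\<And>g. (\<Sum>l\<in>F. q_matrix (erlang_states k) (erlang_rate lam mu k) i l * g l) =
      lam * g (erlang_up k i) + real k * mu * g (erlang_down k i) - (lam + real k * mu) * g i"
    using q_matrix_erlang[OF k ij(1), of lam mu] by blast
  have "(\<Sum>l\<in>F. q_matrix (erlang_states k) (erlang_rate lam mu k) i l) = 0"
    using eq[of "\<lambda>_. 1"] by simp
  from transition_function_backward_equation[OF P deriv t ij F this] show ?thesis
    unfolding eq .
qed

text \<open>The Taylor coefficients of \<open>exp ((lam + nu) t)\<close> times the probability of being empty at time \<open>t\<close>
  when \<open>x\<close> phases are waiting at time \<open>0\<close>; the truncated \<open>x - 1\<close> is the fictitious departure.\<close>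

fun erlang_coeff :: "real \<Rightarrow> real \<Rightarrow> nat \<Rightarrow> nat \<Rightarrow> nat \<Rightarrow> real" where
  "erlang_coeff lam nu k 0 x = (if x = 0 then 1 else 0)"
| "erlang_coeff lam nu k (Suc n) x = lam * erlang_coeff lam nu k n (x + k) + nu * erlang_coeff lam nu k n (x - 1)"

text \<open>Multiplication by \<open>exp (L * t)\<close> removes the diagonal term of the backward
  equation, so the derivative of the remainder of order \<open>N + 1\<close> at \<open>i\<close> is
  a positive combination, of total weight \<open>L\<close>, of the remainders of order
  \<open>N\<close> at the two neighbours. Integrating the bound once per step gives the factorial
  decay; \<open>T\<close> is fixed beforehand so that \<open>exp (L * T)\<close> bounds the case
  \<open>N = 0\<close> for all states alike.\<close>

lemma erlang_taylor_bound:
  fixes lam mu :: real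
  assumes k: "1 \<le> k" and lam: "0 < lam" and mu: "0 < mu" and P: "transition_function (erlang_states k) P"
    and deriv: "\<And>i j. i \<in> erlang_states k \<Longrightarrow> j \<in> erlang_states k \<Longrightarrow>
      ((\<lambda>t. P t i j) has_real_derivative q_matrix (erlang_states k) (erlang_rate lam mu k) i j) (at_right 0)"
  defines "L \<equiv> lam + real k * mu"
  shows "i \<in> erlang_states k \<Longrightarrow> 0 \<le> t \<Longrightarrow> t \<le> T \<Longrightarrow>
    \<bar>exp (L * t) * P t i (0, 0) - (\<Sum>n<N. erlang_coeff lam (real k * mu) k n (erlang_phases k i) * t ^ n / fact n)\<bar>
      \<le> exp (L * T) * (L * t) ^ N / fact N"
proof (induction N arbitrary: i t)
  case 0
  have L: "0 < L" using lam mu k by (auto simp: L_def intro!: add_pos_nonneg)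
  have z: "(0, 0) \<in> erlang_states k" by (simp add: erlang_states_def)
  have "exp (L * t) * P t i (0, 0) \<le> exp (L * T) * 1"
    using 0 L transition_function_le_1[OF P _ _ z] transition_function_nonneg[OF P _ _ z]
    by (intro mult_mono) auto
  then show ?case using 0 transition_function_nonneg[OF P _ _ z] by (simp add: abs_mult)
next
  case (Suc N)
  let ?S = "erlang_states k" and ?K = "\<lambda>n x. erlang_coeff lam (real k * mu) k n x" and ?nu = "real k * mu"
  let ?v = "\<lambda>i t. exp (L * t) * P t i (0, 0)"
  let ?d = "\<lambda>N i t. ?v i t - (\<Sum>n<N. ?K n (erlang_phases k i) * t ^ n / fact n)"
  let ?B = "\<lambda>N t. exp (L * T) * (L * t) ^ N / fact N"
  have L: "0 < L" and nu: "0 < ?nu" using lam mu k by (auto simp: L_def intro!: add_pos_nonneg)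
  have z: "(0, 0) \<in> ?S" by (simp add: erlang_states_def)
  have ud: "erlang_up k i \<in> ?S" "erlang_down k i \<in> ?S"
    using erlang_up_in[OF k Suc.prems(1)] erlang_down_in[OF k Suc.prems(1)] by auto
  have D: "(?d (Suc N) i has_real_derivative lam * ?d N (erlang_up k i) s + ?nu * ?d N (erlang_down k i) s) (at s)"
    if s: "0 < s" for s
  proof -
    have 1: "(?v i has_real_derivative lam * ?v (erlang_up k i) s + ?nu * ?v (erlang_down k i) s) (at s)"
    proof (rule DERIV_cong)
      have "((\<lambda>t. exp (L * t)) has_real_derivative L * exp (L * s)) (at s)"
        by (auto intro!: derivative_eq_intros)
      from DERIV_mult[OF this erlang_backward_equation[OF k P deriv s Suc.prems(1) z]]
      show "(?v i has_real_derivative L * exp (L * s) * P s i (0, 0) + (lam * P s (erlang_up k i) (0, 0)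
        + real k * mu * P s (erlang_down k i) (0, 0) - (lam + real k * mu) * P s i (0, 0)) * exp (L * s)) (at s)" .
    qed (simp add: L_def algebra_simps)
    have 2: "((\<lambda>t. \<Sum>n<Suc N. ?K n (erlang_phases k i) * t ^ n / fact n) has_real_derivative
        (\<Sum>n<N. ?K (Suc n) (erlang_phases k i) * s ^ n / fact n)) (at s)"
    proof -
      have "((\<lambda>t. \<Sum>n<Suc N. ?K n (erlang_phases k i) * t ^ n / fact n) has_real_derivative
        (\<Sum>n<Suc N. ?K n (erlang_phases k i) * (real n * s ^ (n - 1)) / fact n)) (at s)"
        using DERIV_pow by (intro DERIV_sum DERIV_cdivide DERIV_cmult) simp
      also have "(\<Sum>n<Suc N. ?K n (erlang_phases k i) * (real n * s ^ (n - 1)) / fact n)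
          = (\<Sum>n<N. ?K (Suc n) (erlang_phases k i) * (real (Suc n) * s ^ n) / fact (Suc n))"
        by (subst sum.lessThan_Suc_shift) simp
      also have "\<dots> = (\<Sum>n<N. ?K (Suc n) (erlang_phases k i) * s ^ n / fact n)"
        by (intro sum.cong) (auto simp: divide_simps)
      finally show ?thesis .
    qed
    have 3: "(\<Sum>n<N. ?K (Suc n) (erlang_phases k i) * s ^ n / fact n)
      = lam * (\<Sum>n<N. ?K n (erlang_phases k (erlang_up k i)) * s ^ n / fact n)
        + ?nu * (\<Sum>n<N. ?K n (erlang_phases k (erlang_down k i)) * s ^ n / fact n)"
      unfolding sum_distrib_left sum.distrib[symmetric]
      by (intro sum.cong refl) (simp add: erlang_phases_up[OF Suc.prems(1)] erlang_phases_down[OF Suc.prems(1)]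
          distrib_right add_divide_distrib mult.assoc)
    show ?thesis
      by (rule DERIV_cong[OF DERIV_diff[OF 1 2]]) (use 3 in \<open>unfold right_diff_distrib, linarith\<close>)
  qed
  \<comment> \<open>The backward equation is available for positive times only; continuity at
    \<open>0\<close> comes from the differentiability of \<open>P\<close> there.\<close>
  have C: "continuous_on {0..t} (?d (Suc N) i)"
  proof -
    have "continuous (at s within {0..t}) (\<lambda>t. P t i (0, 0))" if "s \<in> {0..t}" for s
    proof (cases "s = 0")
      case True
      have "((\<lambda>t. P t i (0, 0)) \<longlongrightarrow> P 0 i (0, 0)) (at_right 0)"
        by (rule transition_function_tendsto_0[OF P deriv Suc.prems(1) z])
      then have "((\<lambda>t. P t i (0, 0)) \<longlongrightarrow> P 0 i (0, 0)) (at 0 within {0..t})"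
        by (rule tendsto_mono[rotated]) (auto simp: at_within_def intro!: le_infI2)
      then show ?thesis using True by (simp add: continuous_within)
    next
      case False
      then have "0 < s" using that by auto
      from erlang_backward_equation[OF k P deriv this Suc.prems(1) z] show ?thesis
        by (rule DERIV_continuous[OF has_field_derivative_at_within])
    qed
    then have "continuous_on {0..t} (\<lambda>t. P t i (0, 0))"
      unfolding continuous_on_eq_continuous_within by blast
    then show ?thesis by (intro continuous_intros) auto
  qed
  have B: "(?B (Suc N) has_real_derivative L * ?B N s) (at s)" for s
  proof (rule DERIV_cong)
    have "((\<lambda>t. (L * t) ^ Suc N) has_real_derivative real (Suc N) * (L * s) ^ N * L) (at s)"
      by (rule DERIV_cong[OF DERIV_power[OF DERIV_cmult_Id]]) (simp add: mult_ac)
    from DERIV_cdivide[OF DERIV_cmult[OF this]]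
    show "(?B (Suc N) has_real_derivative exp (L * T) * (real (Suc N) * (L * s) ^ N * L) / fact (Suc N)) (at s)" .
    have "real (Suc N) * w / fact (Suc N) = w / fact N" for w :: real
      by (simp del: of_nat_Suc)
    from this[of "exp (L * T) * (L * s) ^ N * L"]
    show "exp (L * T) * (real (Suc N) * (L * s) ^ N * L) / fact (Suc N) = L * ?B N s"
      by (simp only: mult_ac times_divide_eq_right)
  qed
  have tri: "\<bar>lam * a + ?nu * b\<bar> \<le> lam * \<bar>a\<bar> + ?nu * \<bar>b\<bar>" for a b
    using abs_triangle_ineq[of "lam * a" "?nu * b"] lam mu by (simp add: abs_mult)
  have bound: "\<bar>lam * ?d N (erlang_up k i) s + ?nu * ?d N (erlang_down k i) s\<bar> \<le> L * ?B N s"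
    if "0 < s" "s < t" for s
  proof -
    have "\<bar>lam * ?d N (erlang_up k i) s + ?nu * ?d N (erlang_down k i) s\<bar>
      \<le> lam * \<bar>?d N (erlang_up k i) s\<bar> + ?nu * \<bar>?d N (erlang_down k i) s\<bar>"
      by (rule tri)
    also have "\<dots> \<le> lam * ?B N s + ?nu * ?B N s"
      using Suc.IH[OF ud(1), of s] Suc.IH[OF ud(2), of s] that Suc.prems lam nu
      by (intro add_mono mult_left_mono) auto
    also have "\<dots> = L * ?B N s" by (simp only: L_def distrib_right)
    finally show ?thesis .
  qed
  have at0: "?d (Suc N) i 0 = 0"
  proof -
    have "(\<Sum>n<Suc N. ?K n (erlang_phases k i) * 0 ^ n / fact n) = ?K 0 (erlang_phases k i)"
      by (subst sum.lessThan_Suc_shift) simp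
    then show ?thesis using transition_function_0[OF P Suc.prems(1) z] erlang_phases_eq_0[OF Suc.prems(1)] by simp
  qed
  \<comment> \<open>The sum and the difference of \<open>?B (Suc N)\<close> and
    \<open>?d (Suc N) i\<close> vanish at \<open>0\<close> and are nondecreasing, since
    \<open>L * ?B N\<close> dominates the derivative of \<open>?d (Suc N) i\<close>.\<close>
  have "?d (Suc N) i t \<le> ?B (Suc N) t \<and> - ?d (Suc N) i t \<le> ?B (Suc N) t"
  proof (cases "t = 0")
    case True
    then show ?thesis using at0 by simp
  next
    case False
    then have t: "0 < t" using Suc.prems by simp
    have "(\<lambda>t. ?B (Suc N) t - ?d (Suc N) i t) 0 \<le> (\<lambda>t. ?B (Suc N) t - ?d (Suc N) i t) t"
    proof (rule DERIV_nonneg_imp_increasing_open[OF less_imp_le[OF t]])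
      fix s assume s: "0 < s" "s < t"
      show "\<exists>y. ((\<lambda>t. ?B (Suc N) t - ?d (Suc N) i t) has_real_derivative y) (at s) \<and> 0 \<le> y"
        using DERIV_diff[OF B[of s] D[OF s(1)]] bound[OF s] by (intro exI conjI) auto
    qed (intro continuous_intros C, auto)
    moreover have "(\<lambda>t. ?B (Suc N) t + ?d (Suc N) i t) 0 \<le> (\<lambda>t. ?B (Suc N) t + ?d (Suc N) i t) t"
    proof (rule DERIV_nonneg_imp_increasing_open[OF less_imp_le[OF t]])
      fix s assume s: "0 < s" "s < t"
      show "\<exists>y. ((\<lambda>t. ?B (Suc N) t + ?d (Suc N) i t) has_real_derivative y) (at s) \<and> 0 \<le> y"
        using DERIV_add[OF B[of s] D[OF s(1)]] bound[OF s] by (intro exI conjI) auto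
    qed (intro continuous_intros C, auto)
    ultimately show ?thesis unfolding at0 by (simp del: sum.lessThan_Suc)
  qed
  then show ?case by (simp only: abs_le_iff)
qed

lemma erlang_transition_series:
  fixes lam mu :: real
  assumes k: "1 \<le> k" and lam: "0 < lam" and mu: "0 < mu" and P: "transition_function (erlang_states k) P"
    and deriv: "\<And>i j. i \<in> erlang_states k \<Longrightarrow> j \<in> erlang_states k \<Longrightarrow>
      ((\<lambda>t. P t i j) has_real_derivative q_matrix (erlang_states k) (erlang_rate lam mu k) i j) (at_right 0)"
    and t: "0 \<le> t"
  shows "(\<lambda>n. erlang_coeff lam (real k * mu) k n 0 * t ^ n / fact n * exp (- ((lam + real k * mu) * t))) sums P t (0, 0) (0, 0)"
proof -
  let ?L = "lam + real k * mu"
  have z: "(0, 0) \<in> erlang_states k" by (simp add: erlang_states_def)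
  have ph: "erlang_phases k (0, 0) = 0" by (simp add: erlang_phases_def)
  have "(\<lambda>N. (?L * t) ^ N /\<^sub>R fact N) \<longlonglongrightarrow> 0"
    using summable_LIMSEQ_zero[OF sums_summable[OF exp_converges[of "?L * t"]]] .
  then have lim: "(\<lambda>N. exp (?L * t) * (?L * t) ^ N / fact N) \<longlonglongrightarrow> 0"
    using tendsto_mult_right_zero[of "\<lambda>N. (?L * t) ^ N /\<^sub>R fact N" sequentially "exp (?L * t)"]
    by (simp add: divide_inverse mult_ac)
  have "(\<lambda>N. exp (?L * t) * P t (0, 0) (0, 0) - (\<Sum>n<N. erlang_coeff lam (real k * mu) k n 0 * t ^ n / fact n)) \<longlonglongrightarrow> 0"
    by (rule Lim_null_comparison[OF _ lim])
      (use erlang_taylor_bound[OF k lam mu P deriv z t order_refl] ph in auto)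
  from tendsto_diff[OF tendsto_const this, of "exp (?L * t) * P t (0, 0) (0, 0)"]
  have "(\<lambda>n. erlang_coeff lam (real k * mu) k n 0 * t ^ n / fact n) sums (exp (?L * t) * P t (0, 0) (0, 0))"
    by (simp add: sums_def)
  then have s: "(\<lambda>n. erlang_coeff lam (real k * mu) k n 0 * t ^ n / fact n * exp (- (?L * t)))
      sums (exp (?L * t) * P t (0, 0) (0, 0) * exp (- (?L * t)))"
    by (rule sums_mult2)
  have eq: "exp (?L * t) * P t (0, 0) (0, 0) * exp (- (?L * t)) = P t (0, 0) (0, 0)"
    by (simp add: exp_minus)
  show ?thesis using s unfolding eq .
qed

text \<open>With \<open>m = n + 1 - r (k + 1)\<close> this is the density weight of the first passage to level \<open>-m\<close>, after
  \<open>r\<close> upward jumps of size \<open>k\<close>, of the unreflected phase process.\<close>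

definition ballot_coeff :: "real \<Rightarrow> real \<Rightarrow> nat \<Rightarrow> nat \<Rightarrow> nat \<Rightarrow> real" where
  "ballot_coeff lam nu k n r =
     (real n + 1 - real (r * (k + 1))) * lam ^ r * nu ^ (n - r) / (fact r * fact (n + 1 - r))"

text \<open>Decomposition by the first jump: if it goes up, \<open>r - 1\<close> upward jumps
  remain. From \<open>k \<ge> 1\<close> the assumption gives \<open>2 * r \<le> n + 1\<close>, hence
  \<open>r \<le> n\<close>, and no subtraction of naturals is truncated.\<close>

lemma ballot_coeff_Suc:
  assumes "r * (k + 1) \<le> n + 1" "1 \<le> k"
  shows "real (n + 1) * ballot_coeff lam nu k (Suc n) r =
    (if r = 0 then 0 else lam * ballot_coeff lam nu k n (r - 1)) + nu * ballot_coeff lam nu k n r"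
proof -
  have "r * 2 \<le> r * (k + 1)" using assms(2) by (intro mult_le_mono) auto
  also note assms(1)
  finally have rn: "r \<le> n" by simp
  define j where "j = n - r"
  have n: "n = j + r" using rn by (simp add: j_def)
  show ?thesis
  proof (cases r)
    case 0
    then show ?thesis unfolding n by (simp add: ballot_coeff_def field_simps del: fact_Suc) (simp add: field_simps)
  next
    case (Suc r')
    have 1: "j + Suc r' + 1 - r' = Suc (Suc j)" "j + Suc r' + 1 - Suc r' = Suc j" "j + Suc r' - r' = Suc j" "j + Suc r' - Suc r' = j"
      "Suc (j + Suc r') + 1 - Suc r' = Suc (Suc j)" "Suc (j + Suc r') - Suc r' = Suc j" by auto
    show ?thesis unfolding n Suc ballot_coeff_def
      by (simp only: 1 diff_Suc_1 if_False nat.simps) (simp add: divide_simps, simp add: algebra_simps)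
  qed
qed

text \<open>The initial level \<open>x\<close> enters only through the range of \<open>r\<close>. An
  upward jump shifts this range by one, since \<open>r * (k + 1) + x + k \<le> n\<close> means
  \<open>(r + 1) * (k + 1) + x \<le> n + 1\<close>.\<close>

lemma erlang_coeff_eq:
  assumes k: "1 \<le> k"
  shows "erlang_coeff lam nu k n x = fact n * (\<Sum>r | r * (k + 1) + x \<le> n. ballot_coeff lam nu k n r)"
proof (induction n arbitrary: x)
  case 0
  have "{r. r * (k + 1) + x \<le> 0} = (if x = 0 then {0} else {})" by auto
  then show ?case by (simp add: ballot_coeff_def)
next
  case (Suc n)
  let ?R = "\<lambda>n x. {r. r * (k + 1) + x \<le> n}" and ?b = "ballot_coeff lam nu k"
  have fin: "finite (?R n x)" for n x
    by (rule finite_subset[of _ "{..n}"]) auto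
  have 1: "(\<Sum>r\<in>?R n (x + k). ?b n r) = (\<Sum>r\<in>?R (Suc n) x. if r = 0 then 0 else ?b n (r - 1))"
  proof -
    have "(\<Sum>r\<in>?R n (x + k). ?b n r) = (\<Sum>r\<in>{r \<in> ?R (Suc n) x. r \<noteq> 0}. ?b n (r - 1))"
      by (rule sum.reindex_bij_witness[where i="\<lambda>r. r - 1" and j=Suc]) (auto simp: algebra_simps gr0_conv_Suc)
    also have "\<dots> = (\<Sum>r\<in>?R (Suc n) x. if r = 0 then 0 else ?b n (r - 1))"
      using fin by (intro sum.mono_neutral_cong_left) auto
    finally show ?thesis .
  qed
  have 2: "(\<Sum>r\<in>?R n (x - 1). ?b n r) = (\<Sum>r\<in>?R (Suc n) x. ?b n r)"
  proof (rule sum.mono_neutral_left)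
    \<comment> \<open>The ranges can differ only for \<open>x = 0\<close>, where the truncated
      \<open>x - 1\<close> expresses the reflection; an extra index has
      \<open>r * (k + 1) = n + 1\<close>, at which the leading factor of \<open>ballot_coeff\<close>
      vanishes.\<close>
    show "\<forall>r\<in>?R (Suc n) x - ?R n (x - 1). ?b n r = 0"
    proof
      fix r assume "r \<in> ?R (Suc n) x - ?R n (x - 1)"
      then have "r * (k + 1) = n + 1" by auto
      then show "?b n r = 0" unfolding ballot_coeff_def by simp
    qed
  qed (use fin[of _ "Suc n"] in auto)
  have "erlang_coeff lam nu k (Suc n) x = fact n * (lam * (\<Sum>r\<in>?R n (x + k). ?b n r) + nu * (\<Sum>r\<in>?R n (x - 1). ?b n r))"
    by (simp only: erlang_coeff.simps Suc.IH distrib_left mult.left_commute)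
  also have "lam * (\<Sum>r\<in>?R n (x + k). ?b n r) + nu * (\<Sum>r\<in>?R n (x - 1). ?b n r)
      = (\<Sum>r\<in>?R (Suc n) x. (if r = 0 then 0 else lam * ?b n (r - 1)) + nu * ?b n r)"
    unfolding 1 2 sum_distrib_left sum.distrib[symmetric] by (intro sum.cong) auto
  also have "(\<Sum>r\<in>?R (Suc n) x. (if r = 0 then 0 else lam * ?b n (r - 1)) + nu * ?b n r) = (\<Sum>r\<in>?R (Suc n) x. real (n + 1) * ?b (Suc n) r)"
    by (intro sum.cong refl ballot_coeff_Suc[OF _ k, symmetric]) auto
  finally show ?case by (simp add: sum_distrib_left mult_ac)
qed

text \<open>With \<open>n = m + r * (k + 1)\<close> the constraint
  \<open>r * (k + 1) \<le> n\<close> disappears and the sum runs over all pairs; \<open>m\<close>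
  counts from zero here, hence \<open>Suc m\<close> in \<open>A0\<close>. The last factorial in
  \<open>A0\<close> is \<open>fact n\<close>, which cancels the Taylor denominator, and
  non-negativity makes the regrouping unconditional.\<close>

lemma erlang_transition_has_sum:
  fixes lam mu :: real
  assumes k: "1 \<le> k" and lam: "0 < lam" and mu: "0 < mu" and P: "transition_function (erlang_states k) P"
    and deriv: "\<And>i j. i \<in> erlang_states k \<Longrightarrow> j \<in> erlang_states k \<Longrightarrow>
      ((\<lambda>t. P t i j) has_real_derivative q_matrix (erlang_states k) (erlang_rate lam mu k) i j) (at_right 0)"
    and t: "0 \<le> t"
  shows "((\<lambda>(m, r). A0 lam mu k (Suc m) r * (t ^ (m + r * (k + 1)) / fact (m + r * (k + 1)) * exp (- ((lam + real k * mu) * t))))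
    has_sum P t (0, 0) (0, 0)) UNIV"
proof -
  let ?b = "ballot_coeff lam (real k * mu) k" and ?e = "exp (- ((lam + real k * mu) * t))"
  have fin: "finite {r. r * (k + 1) \<le> n}" for n
    by (rule finite_subset[of _ "{..n}"]) auto
  have b0: "0 \<le> ?b n r" if "r * (k + 1) \<le> n" for n r
  proof -
    have "real (r * (k + 1)) \<le> real n" using that by (simp only: of_nat_le_iff)
    then show ?thesis using lam mu unfolding ballot_coeff_def by (intro divide_nonneg_nonneg mult_nonneg_nonneg) auto
  qed
  have inner: "((\<lambda>r. ?b n r * t ^ n * ?e) has_sum erlang_coeff lam (real k * mu) k n 0 * t ^ n / fact n * ?e) {r. r * (k + 1) \<le> n}" for n
    using has_sum_finite[OF fin[of n], of "\<lambda>r. ?b n r * t ^ n * ?e"]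
    by (simp add: erlang_coeff_eq[OF k] sum_distrib_right)
  have outer: "((\<lambda>n. erlang_coeff lam (real k * mu) k n 0 * t ^ n / fact n * ?e) has_sum P t (0, 0) (0, 0)) UNIV"
  proof (rule sums_nonneg_imp_has_sum[OF erlang_transition_series[OF k lam mu P deriv t]])
    show "0 \<le> erlang_coeff lam (real k * mu) k n 0 * t ^ n / fact n * ?e" for n
      using b0 t by (intro has_sum_nonneg[OF inner[of n]]) auto
  qed
  have "((\<lambda>(n, r). ?b n r * t ^ n * ?e) has_sum P t (0, 0) (0, 0)) (SIGMA n:UNIV. {r. r * (k + 1) \<le> n})"
  proof (rule has_sum_SigmaI[OF _ outer])
    show "(\<lambda>(n, r). ?b n r * t ^ n * ?e) summable_on (SIGMA n:UNIV. {r. r * (k + 1) \<le> n})"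
      by (rule summable_on_SigmaI[where g="\<lambda>n. erlang_coeff lam (real k * mu) k n 0 * t ^ n / fact n * ?e"])
        (use inner outer b0 t in \<open>auto simp: summable_on_def\<close>)
  qed (use inner in simp)
  also have "?this \<longleftrightarrow> ?thesis"
  proof (rule has_sum_reindex_bij_witness[where i="\<lambda>(m, r). (m + r * (k + 1), r)" and j="\<lambda>(n, r). (n - r * (k + 1), r)"])
    fix p assume "p \<in> (SIGMA n:UNIV. {r. r * (k + 1) \<le> n})"
    then obtain n r m where p: "p = (n, r)" "n = m + r * (k + 1)" by (auto dest!: le_Suc_ex simp: add.commute)
    have 1: "Suc m + r * k - 1 = n - r" "Suc m + r * k = n + 1 - r" "Suc m + r * (k + 1) - 1 = n"
      "real (Suc m) = real n + 1 - real (r * (k + 1))"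
      unfolding p(2) by (auto simp: algebra_simps)
    have 2: "n - r * (k + 1) = m" "m + r * (k + 1) = n" unfolding p(2) by auto
    show "(case (case p of (n, r) \<Rightarrow> (n - r * (k + 1), r)) of (m, r) \<Rightarrow> A0 lam mu k (Suc m) r * (t ^ (m + r * (k + 1)) / fact (m + r * (k + 1)) * ?e)) =
        (case p of (n, r) \<Rightarrow> ?b n r * t ^ n * ?e)"
      unfolding p(1) prod.case 2 A0_def 1 ballot_coeff_def by simp
  qed auto
  finally show ?thesis .
qed

section \<open>Inverse subordinators\<close>

text \<open>The exponent stays abstract: the law of \<open>Y\<close> at an exponential time of rate
  \<open>z\<close> depends on it only through the value \<open>\<psi> z\<close>, and the stable form
  is inserted when transforms are compared.\<close>

locale subordinator = prob_space M for M :: "'w measure" +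
  fixes D :: "real \<Rightarrow> 'w \<Rightarrow> real" and \<psi> :: "real \<Rightarrow> real"
  assumes levy: "levy_process M D"
    and paths_mono: "\<And>\<omega>. \<omega> \<in> space M \<Longrightarrow> mono_on {0..} (\<lambda>t. D t \<omega>)"
    and laplace: "\<And>t z. 0 \<le> t \<Longrightarrow> 0 < z \<Longrightarrow> expectation (\<lambda>\<omega>. exp (- z * D t \<omega>)) = exp (- t * \<psi> z)"
    and exponent_pos: "\<And>z. 0 < z \<Longrightarrow> 0 < \<psi> z"
begin

abbreviation Y where "Y \<equiv> inverse_subordinator D"

lemma measurable_D: "0 \<le> t \<Longrightarrow> D t \<in> borel_measurable M"
  and AE_D_0: "AE \<omega> in M. D 0 \<omega> = 0"
  and D_right_continuous: "\<omega> \<in> space M \<Longrightarrow> 0 \<le> t \<Longrightarrow> continuous (at_right t) (\<lambda>u. D u \<omega>)"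
  using levy unfolding levy_process_def by blast+

lemma D_mono: "\<omega> \<in> space M \<Longrightarrow> 0 \<le> s \<Longrightarrow> s \<le> t \<Longrightarrow> D s \<omega> \<le> D t \<omega>"
  by (rule mono_onD[where f="\<lambda>t. D t \<omega>", OF paths_mono]) auto

text \<open>A non-integrable function has integral \<open>0\<close>, whereas the transform is an
  exponential and so nonzero.\<close>

lemma integrable_exp_D:
  assumes "0 \<le> t" "0 < z"
  shows "integrable M (\<lambda>\<omega>. exp (- z * D t \<omega>))"
  using laplace[OF assms] not_integrable_integral_eq[of M "\<lambda>\<omega>. exp (- z * D t \<omega>)"] by fastforce

text \<open>By Markov's inequality for \<open>exp (- D n)\<close>, the value \<open>D n\<close> is
  at most \<open>b\<close> with probability at most \<open>exp (b - n * \<psi> 1)\<close>, which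
  tends to zero.\<close>

lemma AE_unbounded_above: "AE \<omega> in M. \<exists>n::nat. b < D (real n) \<omega>"
proof -
  have [measurable]: "D (real n) \<in> borel_measurable M" for n by (rule measurable_D) simp
  let ?A = "{\<omega> \<in> space M. \<forall>n::nat. D (real n) \<omega> \<le> b}"
  have "prob ?A \<le> exp b * exp (- real n * \<psi> 1)" for n :: nat
  proof -
    have "prob ?A \<le> prob {\<omega> \<in> space M. exp (- b) \<le> exp (- 1 * D (real n) \<omega>)}"
      by (rule finite_measure_mono) auto
    also have "\<dots> \<le> expectation (\<lambda>\<omega>. exp (- 1 * D (real n) \<omega>)) / exp (- b)"
      using integrable_exp_D[of "real n" 1] by (intro integral_Markov_inequality_measure[where A="space M"]) auto
    also have "\<dots> = exp (- real n * \<psi> 1) / exp (- b)"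
      by (simp only: laplace[OF of_nat_0_le_iff zero_less_one])
    also have "\<dots> = exp b * exp (- real n * \<psi> 1)" by (simp add: exp_minus field_simps)
    finally show ?thesis .
  qed
  moreover have "(\<lambda>n. exp b * exp (- real n * \<psi> 1)) \<longlonglongrightarrow> 0"
  proof -
    have "(\<lambda>n. exp (- \<psi> 1) ^ n) \<longlonglongrightarrow> 0" using exponent_pos[of 1] by (intro LIMSEQ_realpow_zero) auto
    then have "(\<lambda>n. exp b * exp (- \<psi> 1) ^ n) \<longlonglongrightarrow> exp b * 0" by (rule tendsto_mult_left)
    then show ?thesis by (simp add: exp_of_nat_mult[symmetric])
  qed
  ultimately have "prob ?A \<le> 0" by (metis (no_types, lifting) LIMSEQ_le_const)
  then have "prob ?A = 0" using measure_nonneg[of M ?A] by linarith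
  then have "AE \<omega> in M. \<omega> \<notin> ?A" by (subst (asm) prob_eq_0) auto
  then show ?thesis using AE_space by eventually_elim (auto simp: not_le)
qed

text \<open>Integer levels and times suffice by monotonicity and keep the exceptional set a
  countable union of null sets. On these paths every set
  \<open>{s. 0 \<le> s \<and> t < D s \<omega>}\<close> is nonempty, so the inverse is a genuine
  infimum for \<open>t > 0\<close>.\<close>

definition good_paths :: "'w set" where
  "good_paths = {\<omega> \<in> space M. D 0 \<omega> = 0 \<and> (\<forall>b::nat. \<exists>n::nat. real b < D (real n) \<omega>)}"

lemma AE_good_paths: "AE \<omega> in M. \<omega> \<in> good_paths"
proof -
  have "AE \<omega> in M. \<forall>b::nat. \<exists>n::nat. real b < D (real n) \<omega>"
    using AE_unbounded_above by (simp add: AE_all_countable)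
  then show ?thesis using AE_D_0 AE_space by eventually_elim (auto simp: good_paths_def)
qed

lemma good_paths_unbounded: "\<omega> \<in> good_paths \<Longrightarrow> \<exists>s\<ge>0. t < D s \<omega>"
proof -
  assume w: "\<omega> \<in> good_paths"
  obtain b :: nat where "t < real b" using reals_Archimedean2 by blast
  moreover obtain n where "real b < D (real n) \<omega>" using w by (auto simp: good_paths_def)
  ultimately show ?thesis by (intro exI[of _ "real n"]) auto
qed

lemma good_paths_nonneg: "\<omega> \<in> good_paths \<Longrightarrow> 0 \<le> s \<Longrightarrow> 0 \<le> D s \<omega>"
  using D_mono[of \<omega> 0 s] by (auto simp: good_paths_def)

lemma Y_eq_Inf:
  assumes "\<omega> \<in> good_paths" "0 < t"
  shows "Y t \<omega> = Inf {s. 0 \<le> s \<and> t < D s \<omega>}"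
proof -
  have "\<not> (t = 0 \<or> {s. 0 \<le> s \<and> t < D s \<omega>} = {})" using good_paths_unbounded[OF assms(1), of t] assms(2) by auto
  then show ?thesis by (simp only: inverse_subordinator_def if_False)
qed

lemma Y_nonneg: "0 \<le> Y t \<omega>"
  unfolding inverse_subordinator_def by (auto intro!: cInf_greatest)

text \<open>A countable description valid on all of \<open>space M\<close>, from which joint
  measurability in \<open>(t, \<omega>)\<close> follows, as required for evaluating \<open>Y\<close>
  at a random time. The first two disjuncts are the cases in which the inverse takes the default
  value \<open>0\<close>, below \<open>a\<close>; \<open>max 0\<close> keeps the rational times in
  the range where \<open>D\<close> is measurable.\<close>

lemma Y_less_iff:
  assumes w: "\<omega> \<in> space M" and a: "0 < a"
  shows "Y t \<omega> < a \<longleftrightarrow> t = 0 \<or> (\<forall>n::nat. D (real n) \<omega> \<le> t) \<or> (\<exists>q::rat. of_rat q < a \<and> t < D (max 0 (of_rat q)) \<omega>)"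
proof -
  let ?S = "{s. 0 \<le> s \<and> t < D s \<omega>}"
  have bdd: "bdd_below ?S" by (rule bdd_belowI[of _ 0]) auto
  have empty: "?S = {} \<longleftrightarrow> (\<forall>n::nat. D (real n) \<omega> \<le> t)"
  proof
    show "\<forall>n::nat. D (real n) \<omega> \<le> t" if "?S = {}" using that by (auto simp: not_less)
    show "?S = {}" if b: "\<forall>n::nat. D (real n) \<omega> \<le> t"
    proof -
      have "D s \<omega> \<le> t" if "0 \<le> s" for s
      proof -
        obtain n :: nat where "s \<le> real n" using real_arch_simple by blast
        then show ?thesis using D_mono[OF w that] b by (meson order_trans)
      qed
      then show ?thesis by (auto simp: not_less)
    qed
  qed
  show ?thesis
  proof (cases "t = 0 \<or> ?S = {}")
    case True
    then show ?thesis using a empty by (auto simp: inverse_subordinator_def)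
  next
    case False
    then have ne: "?S \<noteq> {}" and Y: "Y t \<omega> = Inf ?S" by (auto simp: inverse_subordinator_def)
    have "Inf ?S < a \<longleftrightarrow> (\<exists>s\<in>?S. s < a)" by (rule cInf_less_iff[OF ne bdd])
    also have "\<dots> \<longleftrightarrow> (\<exists>q::rat. of_rat q < a \<and> t < D (max 0 (of_rat q)) \<omega>)"
    proof
      assume "\<exists>s\<in>?S. s < a"
      then obtain s where s: "0 \<le> s" "t < D s \<omega>" "s < a" by auto
      obtain q :: rat where q: "s < of_rat q" "of_rat q < a" using of_rat_dense[OF s(3)] by blast
      then have "D s \<omega> \<le> D (max 0 (of_rat q)) \<omega>" using s by (intro D_mono[OF w]) auto
      then show "\<exists>q::rat. of_rat q < a \<and> t < D (max 0 (of_rat q)) \<omega>" using q s by auto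
    next
      assume "\<exists>q::rat. of_rat q < a \<and> t < D (max 0 (of_rat q)) \<omega>"
      then obtain q :: rat where "of_rat q < a" "t < D (max 0 (of_rat q)) \<omega>" by blast
      then show "\<exists>s\<in>?S. s < a" using a by (intro bexI[of _ "max 0 (of_rat q)"]) auto
    qed
    finally show ?thesis using False empty unfolding Y by blast
  qed
qed

lemma measurable_Y_pair: "(\<lambda>(t, \<omega>). Y t \<omega>) \<in> borel_measurable (borel \<Otimes>\<^sub>M M)"
  unfolding borel_measurable_iff_less
proof
  fix a :: real
  have [measurable]: "D (max 0 x) \<in> borel_measurable M" "D (real n) \<in> borel_measurable M" for x n
    by (auto intro!: measurable_D)
  show "{p \<in> space (borel \<Otimes>\<^sub>M M). (case p of (t, \<omega>) \<Rightarrow> Y t \<omega>) < a} \<in> sets (borel \<Otimes>\<^sub>M M)"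
  proof (cases "0 < a")
    case True
    have "{p \<in> space (borel \<Otimes>\<^sub>M M). (case p of (t, \<omega>) \<Rightarrow> Y t \<omega>) < a} =
      {p \<in> space (borel \<Otimes>\<^sub>M M). fst p = 0 \<or> (\<forall>n::nat. D (real n) (snd p) \<le> fst p) \<or>
        (\<exists>q::rat. of_rat q < a \<and> fst p < D (max 0 (of_rat q)) (snd p))}"
      using Y_less_iff[OF _ True] by (auto simp: space_pair_measure)
    also have "\<dots> \<in> sets (borel \<Otimes>\<^sub>M M)" by measurable
    finally show ?thesis .
  next
    case False
    then have "{p \<in> space (borel \<Otimes>\<^sub>M M). (case p of (t, \<omega>) \<Rightarrow> Y t \<omega>) < a} = {}"
      using Y_nonneg by (auto simp: not_less intro: order_trans)
    then show ?thesis by (simp only: sets.empty_sets)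
  qed
qed

lemma measurable_Y: "Y t \<in> borel_measurable M"
  using measurable_Pair2[OF measurable_Y_pair, of t] by simp

text \<open>The hard direction rests on right-continuity: from \<open>D s < t\<close> the path stays
  below \<open>t\<close> for a while after \<open>s\<close>, so the infimum exceeds
  \<open>s\<close>. At the level \<open>t = D s\<close> the equivalence can fail, which costs
  nothing when \<open>t\<close> has a law without atoms.\<close>

lemma Y_le_iff:
  assumes w: "\<omega> \<in> good_paths" and t: "0 < t" "t \<noteq> D s \<omega>" and s: "0 \<le> s"
  shows "Y t \<omega> \<le> s \<longleftrightarrow> t < D s \<omega>"
proof -
  let ?S = "{s. 0 \<le> s \<and> t < D s \<omega>}"
  have ws: "\<omega> \<in> space M" using w by (simp add: good_paths_def)
  have ne: "?S \<noteq> {}" using good_paths_unbounded[OF w, of t] by auto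
  have bdd: "bdd_below ?S" by (rule bdd_belowI[of _ 0]) auto
  have Y: "Y t \<omega> = Inf ?S" by (rule Y_eq_Inf[OF w t(1)])
  show ?thesis
  proof
    assume "t < D s \<omega>"
    then show "Y t \<omega> \<le> s" unfolding Y using s bdd by (intro cInf_lower) auto
  next
    assume le: "Y t \<omega> \<le> s"
    show "t < D s \<omega>"
    proof (rule ccontr)
      assume "\<not> t < D s \<omega>"
      then have "D s \<omega> < t" using t by simp
      moreover have "((\<lambda>u. D u \<omega>) \<longlongrightarrow> D s \<omega>) (at_right s)"
        using D_right_continuous[OF ws s] by (simp add: continuous_within)
      ultimately have "\<forall>\<^sub>F u in at_right s. D u \<omega> < t" by (intro order_tendstoD)
      then obtain b where b: "s < b" "\<And>u. s < u \<Longrightarrow> u < b \<Longrightarrow> D u \<omega> < t"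
        by (auto simp: eventually_at_right[of s "s + 1"])
      obtain u where u: "s < u" "u < b" using dense[OF b(1)] by blast
      have "u \<le> Inf ?S"
      proof (rule cInf_greatest[OF ne])
        fix x assume x: "x \<in> ?S"
        show "u \<le> x"
        proof (rule ccontr)
          assume "\<not> u \<le> x"
          then have "D x \<omega> \<le> D u \<omega>" using x by (intro D_mono[OF ws]) auto
          then show False using b(2)[OF u] x by simp
        qed
      qed
      then show False using le u Y by simp
    qed
  qed
qed

lemma Y_mono: "\<omega> \<in> good_paths \<Longrightarrow> 0 < t \<Longrightarrow> t \<le> t' \<Longrightarrow> Y t \<omega> \<le> Y t' \<omega>"
proof -
  assume w: "\<omega> \<in> good_paths" and t: "0 < t" "t \<le> t'"
  have ne: "{s. 0 \<le> s \<and> x < D s \<omega>} \<noteq> {}" for x using good_paths_unbounded[OF w, of x] by auto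
  have "Inf {s. 0 \<le> s \<and> t < D s \<omega>} \<le> Inf {s. 0 \<le> s \<and> t' < D s \<omega>}"
    using t by (intro cInf_superset_mono ne bdd_belowI[of _ 0]) auto
  then show ?thesis using t w by (simp add: Y_eq_Inf)
qed

lemma Y_right_continuous:
  assumes w: "\<omega> \<in> good_paths" and t: "0 < t"
  shows "((\<lambda>u. Y u \<omega>) \<longlongrightarrow> Y t \<omega>) (at_right t)"
proof (rule order_tendstoI)
  fix a assume "a < Y t \<omega>"
  then have "a < Y u \<omega>" if "t < u" for u using Y_mono[OF w t less_imp_le[OF that]] by simp
  then show "\<forall>\<^sub>F u in at_right t. a < Y u \<omega>" by (auto simp: eventually_at_filter)
next
  fix a assume a: "Y t \<omega> < a"
  let ?S = "\<lambda>t. {s. 0 \<le> s \<and> t < D s \<omega>}"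
  have ne: "?S x \<noteq> {}" for x using good_paths_unbounded[OF w, of x] by auto
  have bdd: "bdd_below (?S x)" for x by (rule bdd_belowI[of _ 0]) auto
  have "Inf (?S t) < a" using a t w by (simp add: Y_eq_Inf)
  then obtain s where s: "0 \<le> s" "t < D s \<omega>" "s < a" using cInf_less_iff[OF ne bdd] by auto
  \<comment> \<open>The witness \<open>s\<close> for level \<open>t\<close> remains one for every
    level \<open>u < D s \<omega>\<close>.\<close>
  have "Y u \<omega> < a" if "t < u" "u < D s \<omega>" for u
  proof -
    have "Inf (?S u) \<le> s" using s that bdd by (intro cInf_lower) auto
    then show ?thesis using that t w s by (simp add: Y_eq_Inf)
  qed
  then show "\<forall>\<^sub>F u in at_right t. Y u \<omega> < a"
    using s(2) unfolding eventually_at_right[OF s(2)] by blast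
qed

lemma expectation_Y_right_continuous:
  fixes \<phi> :: "real \<Rightarrow> real"
  assumes cont: "continuous_on UNIV \<phi>" and bound: "\<And>y. 0 \<le> y \<Longrightarrow> \<bar>\<phi> y\<bar> \<le> C" and t: "0 < t"
  shows "((\<lambda>u. expectation (\<lambda>\<omega>. \<phi> (Y u \<omega>))) \<longlongrightarrow> expectation (\<lambda>\<omega>. \<phi> (Y t \<omega>))) (at_right t)"
proof (rule tendsto_at_right_sequentially[of _ "t + 1"])
  have [measurable]: "\<phi> \<in> borel_measurable borel" using cont by (rule borel_measurable_continuous_onI)
  note measurable_Y[measurable]
  fix S :: "nat \<Rightarrow> real" assume S: "\<And>n. t < S n" "S \<longlonglongrightarrow> t"
  show "(\<lambda>n. expectation (\<lambda>\<omega>. \<phi> (Y (S n) \<omega>))) \<longlonglongrightarrow> expectation (\<lambda>\<omega>. \<phi> (Y t \<omega>))"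
  proof (rule integral_dominated_convergence[where w="\<lambda>_. C"])
    show "AE \<omega> in M. (\<lambda>n. \<phi> (Y (S n) \<omega>)) \<longlonglongrightarrow> \<phi> (Y t \<omega>)"
      using AE_good_paths
    proof eventually_elim
      case (elim \<omega>)
      have "S n \<noteq> t" for n using S(1)[of n] by simp
      then have "filterlim S (at_right t) sequentially"
        using S by (auto simp: filterlim_at)
      from filterlim_compose[OF Y_right_continuous[OF elim t] this]
      have "(\<lambda>n. Y (S n) \<omega>) \<longlonglongrightarrow> Y t \<omega>" .
      then show ?case using cont by (intro isCont_tendsto_compose[of _ \<phi>]) (auto simp: continuous_on_eq_continuous_at)
    qed
  qed (auto intro!: bound Y_nonneg)
qed simp

text \<open>The independent exponential time is the first coordinate of a product space. Up to null
  sets \<open>Y \<le> a\<close> means that this time is below \<open>D a\<close>, which given the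
  path has probability \<open>1 - exp (- z * D a)\<close>; averaging yields
  \<open>1 - exp (- a * \<psi> z)\<close>, an exponential distribution function.\<close>

lemma distributed_Y_exponential_time:
  assumes z: "0 < z"
  shows "distributed (density lborel (exponential_density z) \<Otimes>\<^sub>M M) lborel (\<lambda>(t, \<omega>). Y t \<omega>) (exponential_density (\<psi> z))"
proof -
  let ?E = "density lborel (exponential_density z)"
  interpret E: prob_space ?E by (rule prob_space_exponential_density[OF z])
  interpret EM: pair_prob_space ?E M ..
  have [measurable_cong]: "sets ?E = sets borel" by simp
  have meas: "(\<lambda>(t, \<omega>). Y t \<omega>) \<in> borel_measurable (?E \<Otimes>\<^sub>M M)"
    using measurable_Y_pair by (subst measurable_cong_sets[OF sets_pair_measure_cong refl]) auto
  show ?thesis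
  proof (subst EM.exponential_distributed_iff[OF exponent_pos[OF z]], intro conjI allI impI)
    show "(\<lambda>(t, \<omega>). Y t \<omega>) \<in> borel_measurable (?E \<Otimes>\<^sub>M M)" by (rule meas)
    fix a :: real assume a: "0 \<le> a"
    let ?A = "{p \<in> space (?E \<Otimes>\<^sub>M M). (case p of (t, \<omega>) \<Rightarrow> Y t \<omega>) \<le> a}"
    have A: "?A \<in> sets (?E \<Otimes>\<^sub>M M)" using borel_measurable_le[OF meas borel_measurable_const] .
    have [measurable]: "D a \<in> borel_measurable M" by (rule measurable_D[OF a])
    have "emeasure (?E \<Otimes>\<^sub>M M) ?A = (\<integral>\<^sup>+\<omega>. emeasure ?E ((\<lambda>t. (t, \<omega>)) -` ?A) \<partial>M)"
      by (rule EM.emeasure_pair_measure_alt2[OF A])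
    also have "\<dots> = (\<integral>\<^sup>+\<omega>. ennreal (1 - exp (- z * D a \<omega>)) \<partial>M)"
    proof (rule nn_integral_cong_AE)
      show "AE \<omega> in M. emeasure ?E ((\<lambda>t. (t, \<omega>)) -` ?A) = ennreal (1 - exp (- z * D a \<omega>))"
        using AE_good_paths
      proof eventually_elim
        case (elim \<omega>)
        have sp: "\<omega> \<in> space M" using elim by (simp add: good_paths_def)
        have "emeasure ?E ((\<lambda>t. (t, \<omega>)) -` ?A) = emeasure ?E {..D a \<omega>}"
        proof (rule emeasure_eq_AE)
          have "AE t in lborel. 0 < ennreal (exponential_density z t) \<longrightarrow>
            (t \<in> (\<lambda>t. (t, \<omega>)) -` ?A) = (t \<in> {..D a \<omega>})"
          proof (rule AE_I[of _ _ "{0, D a \<omega>}"])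
            have "(t \<in> (\<lambda>t. (t, \<omega>)) -` ?A) = (t \<in> {..D a \<omega>})"
              if "0 < ennreal (exponential_density z t)" "t \<noteq> 0" "t \<noteq> D a \<omega>" for t
            proof -
              have "0 < t" using that by (auto simp: exponential_density_def split: if_splits)
              then show ?thesis using Y_le_iff[OF elim _ that(3) a] that sp by (auto simp: space_pair_measure)
            qed
            then show "{t \<in> space lborel. \<not> (0 < ennreal (exponential_density z t) \<longrightarrow>
              (t \<in> (\<lambda>t. (t, \<omega>)) -` ?A) = (t \<in> {..D a \<omega>}))} \<subseteq> {0, D a \<omega>}" by blast
          qed (auto intro!: emeasure_lborel_countable)
          then show "AE t in ?E. (t \<in> (\<lambda>t. (t, \<omega>)) -` ?A) = (t \<in> {..D a \<omega>})"
            by (subst AE_density) auto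
          show "(\<lambda>t. (t, \<omega>)) -` ?A \<in> sets ?E" using sets_Pair2[OF A] .
        qed auto
        also have "\<dots> = ennreal (1 - exp (- z * D a \<omega>))"
          using emeasure_erlang_density[OF z, of 0 "D a \<omega>"] good_paths_nonneg[OF elim a] by (simp add: erlang_CDF_0)
        finally show ?case .
      qed
    qed
    also have "\<dots> = ennreal (expectation (\<lambda>\<omega>. 1 - exp (- z * D a \<omega>)))"
    proof (rule nn_integral_eq_integral)
      show "AE \<omega> in M. 0 \<le> 1 - exp (- z * D a \<omega>)"
        using AE_good_paths by eventually_elim (use good_paths_nonneg[OF _ a] z in auto)
    qed (use integrable_exp_D[OF a z] in auto)
    also have "\<dots> = ennreal (1 - exp (- a * \<psi> z))"
      using integrable_exp_D[OF a z] laplace[OF a z] by (simp add: prob_space)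
    finally show "EM.prob ?A = 1 - exp (- a * \<psi> z)"
      using a exponent_pos[OF z] by (simp add: measure_def)
  qed
qed

text \<open>Up to a factor \<open>z\<close>, the Laplace integral is the mean of
  \<open>\<phi>\<close> at \<open>Y\<close> taken at an exponential time, hence an integral against
  the exponential density of rate \<open>\<psi> z\<close>. The product of that density with
  \<open>\<phi>\<close> is \<open>\<psi> z / (L + \<psi> z) ^ Suc n\<close> times an Erlang density,
  which has mass one.\<close>

lemma laplace_transform_expectation_Y:
  fixes n :: nat and L z :: real
  assumes L: "0 < L" and z: "0 < z"
  defines "\<phi> \<equiv> (\<lambda>y. y ^ n / fact n * exp (- (L * y)))"
  assumes bound: "\<And>y. 0 \<le> y \<Longrightarrow> \<bar>\<phi> y\<bar> \<le> C"
  shows "has_bochner_integral lborel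
    (\<lambda>t. indicator {0<..} t * (expectation (\<lambda>\<omega>. \<phi> (Y t \<omega>)) * exp (- (z * t)))) (\<psi> z / z / (L + \<psi> z) ^ Suc n)"
proof -
  let ?E = "density lborel (exponential_density z)"
  interpret E: prob_space ?E by (rule prob_space_exponential_density[OF z])
  interpret EM: pair_prob_space ?E M ..
  have p: "0 < \<psi> z" by (rule exponent_pos[OF z])
  have [measurable]: "\<phi> \<in> borel_measurable borel" unfolding \<phi>_def by measurable
  have [measurable]: "(\<lambda>(t, \<omega>). Y t \<omega>) \<in> borel_measurable (?E \<Otimes>\<^sub>M M)"
    using distributed_measurable[OF distributed_Y_exponential_time[OF z]] by simp
  let ?f = "\<lambda>(t, \<omega>). \<phi> (Y t \<omega>)"
  have "?f \<in> borel_measurable (?E \<Otimes>\<^sub>M M)"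
    using measurable_compose[of "\<lambda>(t, \<omega>). Y t \<omega>" "?E \<Otimes>\<^sub>M M" borel \<phi> borel] by (simp add: case_prod_unfold)
  then have int: "integrable (?E \<Otimes>\<^sub>M M) ?f"
    by (intro EM.integrable_const_bound[of _ C]) (auto intro!: AE_I2 bound Y_nonneg simp: case_prod_unfold)
  have "(\<integral>p. ?f p \<partial>(?E \<Otimes>\<^sub>M M)) = (\<integral>y. exponential_density (\<psi> z) y * \<phi> y \<partial>lborel)"
    using distributed_integral[OF distributed_Y_exponential_time[OF z], of \<phi>] p
    by (simp add: case_prod_unfold exponential_density_nonneg)
  also have "\<dots> = (\<integral>y. \<psi> z / (L + \<psi> z) ^ Suc n * erlang_density n (L + \<psi> z) y \<partial>lborel)"
  proof -
    have "a * exp (- a * y) * (y ^ n / fact n * exp (- (L * y))) = a / K * (K * y ^ n * exp (- (L + a) * y) / fact n)"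
      if "K \<noteq> 0" for a K y :: real
    proof -
      have "exp (- (L + a) * y) = exp (- a * y) * exp (- (L * y))"
        by (simp add: exp_add[symmetric] algebra_simps)
      then show ?thesis using that by simp
    qed
    note eq = this
    have "exponential_density (\<psi> z) y * \<phi> y = \<psi> z / (L + \<psi> z) ^ Suc n * erlang_density n (L + \<psi> z) y" for y
    proof (cases "y < 0")
      case False
      then show ?thesis unfolding \<phi>_def erlang_density_def exponential_density_def
        using eq[of "(L + \<psi> z) ^ Suc n" "\<psi> z" y] L p by (simp only: if_False) simp
    qed (simp add: erlang_density_def exponential_density_def)
    then show ?thesis by simp
  qed
  also have "\<dots> = \<psi> z / (L + \<psi> z) ^ Suc n"
  proof -
    have "has_bochner_integral lborel (erlang_density n (L + \<psi> z)) 1"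
      using nn_integral_erlang_ith_moment[of "L + \<psi> z" n 0] L p
      by (intro has_bochner_integral_nn_integral) auto
    then show ?thesis by (simp add: has_bochner_integral_iff)
  qed
  finally have val: "(\<integral>p. ?f p \<partial>(?E \<Otimes>\<^sub>M M)) = \<psi> z / (L + \<psi> z) ^ Suc n" .
  have "(\<integral>t. expectation (\<lambda>\<omega>. \<phi> (Y t \<omega>)) \<partial>?E) = \<psi> z / (L + \<psi> z) ^ Suc n"
    using EM.integral_fst'[OF int] val by simp
  moreover have intE: "integrable ?E (\<lambda>t. expectation (\<lambda>\<omega>. \<phi> (Y t \<omega>)))"
    using EM.integrable_fst'[OF int] by simp
  moreover have [measurable]: "(\<lambda>t. expectation (\<lambda>\<omega>. \<phi> (Y t \<omega>))) \<in> borel_measurable lborel"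
    using borel_measurable_integrable[OF intE] by simp
  ultimately have "has_bochner_integral lborel (\<lambda>t. exponential_density z t * expectation (\<lambda>\<omega>. \<phi> (Y t \<omega>))) (\<psi> z / (L + \<psi> z) ^ Suc n)"
    using z by (simp add: has_bochner_integral_iff integral_real_density integrable_real_density exponential_density_nonneg)
  from has_bochner_integral_mult_left[OF this, of "1 / z"]
  have "has_bochner_integral lborel (\<lambda>t. exponential_density z t * expectation (\<lambda>\<omega>. \<phi> (Y t \<omega>)) * (1 / z)) (\<psi> z / z / (L + \<psi> z) ^ Suc n)"
    by (simp add: mult_ac)
  then show ?thesis
  proof (subst (asm) has_bochner_integral_cong_AE[of _ _ "\<lambda>t. indicator {0<..} t * (expectation (\<lambda>\<omega>. \<phi> (Y t \<omega>)) * exp (- (z * t)))"])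
    show "AE t in lborel. exponential_density z t * expectation (\<lambda>\<omega>. \<phi> (Y t \<omega>)) * (1 / z)
      = indicator {0<..} t * (expectation (\<lambda>\<omega>. \<phi> (Y t \<omega>)) * exp (- (z * t)))"
      by (rule AE_I[of _ _ "{0}"]) (use z in \<open>auto simp: exponential_density_def indicator_def mult_ac\<close>)
  qed auto
qed

end

section \<open>The time-changed queue\<close>

context prob_space
begin

text \<open>Paths are locally constant to the right, so the indicators converge pointwise and the
  probabilities follow by dominated convergence.\<close>

lemma prob_right_continuous:
  fixes X :: "real \<Rightarrow> 'a \<Rightarrow> 's"
  assumes X: "\<And>u. 0 \<le> u \<Longrightarrow> {\<omega> \<in> space M. X u \<omega> = x} \<in> events"
    and rc: "\<And>\<omega> u. \<omega> \<in> space M \<Longrightarrow> 0 \<le> u \<Longrightarrow> \<forall>\<^sub>F v in at_right u. X v \<omega> = X u \<omega>"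
    and u: "0 \<le> u" and S: "\<And>n. u < S n" "S \<longlonglongrightarrow> u"
  shows "(\<lambda>n. prob {\<omega> \<in> space M. X (S n) \<omega> = x}) \<longlonglongrightarrow> prob {\<omega> \<in> space M. X u \<omega> = x}"
proof -
  have Su: "S n \<noteq> u" "0 \<le> S n" for n using S(1)[of n] u by auto
  have "filterlim S (at_right u) sequentially" using S Su by (auto simp: filterlim_at)
  then have ev: "\<forall>\<^sub>F n in sequentially. X (S n) \<omega> = X u \<omega>" if "\<omega> \<in> space M" for \<omega>
    using rc[OF that u] by (rule eventually_compose_filterlim[rotated])
  have "(\<lambda>n. \<integral>\<omega>. indicator {\<omega> \<in> space M. X (S n) \<omega> = x} \<omega> \<partial>M)
      \<longlonglongrightarrow> (\<integral>\<omega>. (indicator {\<omega> \<in> space M. X u \<omega> = x} \<omega> :: real) \<partial>M)"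
  proof (rule integral_dominated_convergence[where w="\<lambda>_. 1"])
    show "AE \<omega> in M. (\<lambda>n. indicator {\<omega> \<in> space M. X (S n) \<omega> = x} \<omega>) \<longlonglongrightarrow> (indicator {\<omega> \<in> space M. X u \<omega> = x} \<omega> :: real)"
      using AE_space
    proof eventually_elim
      case (elim \<omega>)
      show ?case using ev[OF elim] by (intro tendsto_eventually) (auto elim!: eventually_mono simp: indicator_def)
    qed
  qed (use X u Su in auto)
  then show ?thesis using X u Su by simp
qed

text \<open>The time is discretised from above, so that right-continuity of the paths applies.\<close>

lemma prob_time_change:
  fixes X :: "real \<Rightarrow> 'a \<Rightarrow> 's" and Y :: "'a \<Rightarrow> real"
  assumes X: "\<And>u. 0 \<le> u \<Longrightarrow> {\<omega> \<in> space M. X u \<omega> = x} \<in> events"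
    and rc: "\<And>\<omega> u. \<omega> \<in> space M \<Longrightarrow> 0 \<le> u \<Longrightarrow> \<forall>\<^sub>F v in at_right u. X v \<omega> = X u \<omega>"
    and Y[measurable]: "Y \<in> borel_measurable M" and Y0: "\<And>\<omega>. 0 \<le> Y \<omega>"
    and indep: "\<And>u B. 0 \<le> u \<Longrightarrow> B \<in> sets borel \<Longrightarrow>
      prob ({\<omega> \<in> space M. X u \<omega> = x} \<inter> (Y -` B \<inter> space M)) = prob {\<omega> \<in> space M. X u \<omega> = x} * prob (Y -` B \<inter> space M)"
  shows "{\<omega> \<in> space M. X (Y \<omega>) \<omega> = x} \<in> events"
    and "prob {\<omega> \<in> space M. X (Y \<omega>) \<omega> = x} = expectation (\<lambda>\<omega>. prob {\<omega>' \<in> space M. X (Y \<omega>) \<omega>' = x})"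
proof -
  define p where "p u = prob {\<omega> \<in> space M. X u \<omega> = x}" for u
  \<comment> \<open>\<open>W N\<close> will be the first point strictly above \<open>Y\<close> of
    the grid with mesh \<open>1 / real (Suc N)\<close>. Strictness makes it approach
    \<open>Y\<close> from the right even where \<open>Y\<close> lies on the grid.\<close>
  define K where "K N \<omega> = nat \<lfloor>Y \<omega> * real (Suc N)\<rfloor>" for N \<omega>
  define W where "W N \<omega> = (real (K N \<omega>) + 1) / real (Suc N)" for N \<omega>
  have [measurable]: "K N \<in> measurable M (count_space UNIV)" for N unfolding K_def by measurable
  have W: "Y \<omega> < W N \<omega>" "W N \<omega> \<le> Y \<omega> + 1 / real (Suc N)" for N \<omega>
  proof -
    have "0 \<le> Y \<omega> * real (Suc N)" using Y0 by simp
    then have "real (K N \<omega>) \<le> Y \<omega> * real (Suc N)" "Y \<omega> * real (Suc N) < real (K N \<omega>) + 1"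
      unfolding K_def by linarith+
    then show "Y \<omega> < W N \<omega>" "W N \<omega> \<le> Y \<omega> + 1 / real (Suc N)"
      unfolding W_def by (simp_all add: field_simps del: of_nat_Suc)
  qed
  have W0: "0 \<le> W N \<omega>" "W N \<omega> \<noteq> Y \<omega>" for N \<omega> using W(1)[of \<omega> N] Y0[of \<omega>] by auto
  have Wlim: "(\<lambda>N. W N \<omega>) \<longlonglongrightarrow> Y \<omega>" for \<omega>
  proof (rule real_tendsto_sandwich)
    show "\<forall>\<^sub>F N in sequentially. Y \<omega> \<le> W N \<omega>" using W(1) by (intro eventuallyI less_imp_le)
    show "\<forall>\<^sub>F N in sequentially. W N \<omega> \<le> Y \<omega> + 1 / real (Suc N)" using W(2) by (intro eventuallyI)
    have "(\<lambda>N. Y \<omega> + 1 / real (Suc N)) \<longlonglongrightarrow> Y \<omega> + 0"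
      using LIMSEQ_inverse_real_of_nat by (intro tendsto_add tendsto_const) (simp add: inverse_eq_divide)
    then show "(\<lambda>N. Y \<omega> + 1 / real (Suc N)) \<longlonglongrightarrow> Y \<omega>" by simp
  qed simp
  have Wr: "filterlim (\<lambda>N. W N \<omega>) (at_right (Y \<omega>)) sequentially" for \<omega>
    using Wlim W(1) W0(2) by (auto simp: filterlim_at)
  let ?E = "\<lambda>u. {\<omega> \<in> space M. X u \<omega> = x}"
  let ?A = "\<lambda>N. {\<omega> \<in> space M. X (W N \<omega>) \<omega> = x}"
  let ?w = "\<lambda>N j. (real j + 1) / real (Suc N)"
  let ?C = "\<lambda>N j. {\<omega> \<in> space M. K N \<omega> = j}"
  have w0: "0 \<le> ?w N j" for N j by simp
  have A: "?A N = (\<Union>j. ?E (?w N j) \<inter> ?C N j)" for N by (auto simp: W_def)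
  have Am: "?A N \<in> events" for N unfolding A using X[OF w0] by (intro sets.countable_UN) auto
  have ind: "prob (?E (?w N j) \<inter> ?C N j) = p (?w N j) * prob (?C N j)" for N j
  proof -
    have "(\<lambda>y. nat \<lfloor>y * real (Suc N)\<rfloor>) -` {j} \<inter> space borel \<in> sets borel"
      by (rule measurable_sets[of _ borel "count_space UNIV"]) auto
    moreover have "?C N j = Y -` ((\<lambda>y. nat \<lfloor>y * real (Suc N)\<rfloor>) -` {j}) \<inter> space M"
      by (auto simp: K_def)
    ultimately show ?thesis using indep[OF w0, of "(\<lambda>y. nat \<lfloor>y * real (Suc N)\<rfloor>) -` {j}" j N] by (simp add: p_def)
  qed
  have step: "prob (?A N) = expectation (\<lambda>\<omega>. p (W N \<omega>))" for N
  proof -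
    have 1: "(\<lambda>j. p (?w N j) * prob (?C N j)) sums prob (?A N)"
      unfolding A ind[symmetric] using X[OF w0] by (intro finite_measure_UNION) (auto simp: disjoint_family_on_def)
    let ?f = "\<lambda>j \<omega>. p (?w N j) * indicator (?C N j) \<omega>"
    have single: "(\<lambda>j. ?f j \<omega>) sums p (W N \<omega>)" if "\<omega> \<in> space M" for \<omega>
    proof -
      have "?f j \<omega> = (if j = K N \<omega> then p (W N \<omega>) else 0)" for j
        using that by (auto simp: W_def)
      then show ?thesis using sums_single[of "K N \<omega>" "\<lambda>_. p (W N \<omega>)"] by simp
    qed
    have nn: "norm (?f j \<omega>) = ?f j \<omega>" for j \<omega> by (simp add: p_def abs_mult)
    have int: "integrable M (?f j)" for j by (intro integrable_mult_right integrable_real_indicator) (auto simp: less_top[symmetric])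
    have val: "(\<integral>\<omega>. ?f j \<omega> \<partial>M) = p (?w N j) * prob (?C N j)" for j by simp
    have "(\<lambda>j. \<integral>\<omega>. ?f j \<omega> \<partial>M) sums (\<integral>\<omega>. (\<Sum>j. ?f j \<omega>) \<partial>M)"
    proof (rule sums_integral[OF int])
      show "AE \<omega> in M. summable (\<lambda>j. norm (?f j \<omega>))"
        unfolding nn using single by (intro AE_I2) (auto dest: sums_summable)
      show "summable (\<lambda>j. \<integral>\<omega>. norm (?f j \<omega>) \<partial>M)"
        unfolding nn val using 1 by (rule sums_summable)
    qed
    moreover have "(\<integral>\<omega>. (\<Sum>j. ?f j \<omega>) \<partial>M) = expectation (\<lambda>\<omega>. p (W N \<omega>))"
      using sums_unique[OF single] by (intro Bochner_Integration.integral_cong) auto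
    ultimately have "(\<lambda>j. p (?w N j) * prob (?C N j)) sums expectation (\<lambda>\<omega>. p (W N \<omega>))"
      unfolding val by (simp only:)
    with 1 show ?thesis by (rule sums_unique2)
  qed
  \<comment> \<open>Measurability of \<open>p\<close> is not at hand, but any function of the
    discrete \<open>K N\<close> is measurable, and \<open>p\<close> composed with \<open>Y\<close>
    then becomes measurable as a pointwise limit.\<close>
  have pW[measurable]: "(\<lambda>\<omega>. p (W N \<omega>)) \<in> borel_measurable M" for N
    unfolding W_def by (rule measurable_compose[of "K N" M "count_space UNIV"]) auto
  have plim: "(\<lambda>N. p (W N \<omega>)) \<longlonglongrightarrow> p (Y \<omega>)" for \<omega>
    unfolding p_def by (rule prob_right_continuous[OF X rc Y0 W(1) Wlim])
  have [measurable]: "(\<lambda>\<omega>. p (Y \<omega>)) \<in> borel_measurable M"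
    by (rule borel_measurable_LIMSEQ_real[OF plim pW])
  have lim1: "(\<lambda>N. expectation (\<lambda>\<omega>. p (W N \<omega>))) \<longlonglongrightarrow> expectation (\<lambda>\<omega>. p (Y \<omega>))"
  proof (rule integral_dominated_convergence[where w="\<lambda>_. 1"])
    have "norm (p u) \<le> 1" for u by (simp add: p_def)
    then show "AE \<omega> in M. norm (p (W N \<omega>)) \<le> 1" for N by simp
  qed (use plim in auto)
  let ?g = "\<lambda>N \<omega>. indicator (?A N) \<omega> :: real" and ?h = "indicator {\<omega> \<in> space M. X (Y \<omega>) \<omega> = x} :: 'a \<Rightarrow> real"
  have glim: "(\<lambda>N. ?g N \<omega>) \<longlonglongrightarrow> ?h \<omega>" if "\<omega> \<in> space M" for \<omega>
  proof -
    have "\<forall>\<^sub>F N in sequentially. X (W N \<omega>) \<omega> = X (Y \<omega>) \<omega>"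
      using rc[OF that Y0] Wr by (rule eventually_compose_filterlim)
    then show ?thesis by (intro tendsto_eventually) (auto elim!: eventually_mono simp: indicator_def)
  qed
  have gm: "?g N \<in> borel_measurable M" for N using Am by simp
  have hm: "?h \<in> borel_measurable M"
    by (rule borel_measurable_LIMSEQ_real[OF glim gm])
  have "(\<lambda>N. expectation (?g N)) \<longlonglongrightarrow> expectation ?h"
    by (rule integral_dominated_convergence[where w="\<lambda>_. 1"]) (use glim gm hm in \<open>auto intro!: AE_I2 simp: indicator_def\<close>)
  moreover have "expectation (?g N) = expectation (\<lambda>\<omega>. p (W N \<omega>))" for N
    using step[of N] Am[of N] by simp
  ultimately have "expectation ?h = expectation (\<lambda>\<omega>. p (Y \<omega>))"
    using lim1 LIMSEQ_unique by simp
  moreover have "{\<omega> \<in> space M. X (Y \<omega>) \<omega> = x} \<inter> space M = {\<omega> \<in> space M. X (Y \<omega>) \<omega> = x}" by auto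
  then show "{\<omega> \<in> space M. X (Y \<omega>) \<omega> = x} \<in> events"
    using hm unfolding borel_measurable_indicator_iff by (simp only:)
  ultimately show "prob {\<omega> \<in> space M. X (Y \<omega>) \<omega> = x} = expectation (\<lambda>\<omega>. prob {\<omega>' \<in> space M. X (Y \<omega>) \<omega>' = x})"
    by (simp add: p_def)
qed

text \<open>Monotone convergence for double series: the partial sums are non-negative and at most
  \<open>C\<close>, and so are their expectations.\<close>

lemma has_sum_expectation_nonneg:
  fixes g :: "nat \<times> nat \<Rightarrow> 'a \<Rightarrow> real"
  assumes g[measurable]: "\<And>i. g i \<in> borel_measurable M" and nonneg: "\<And>i \<omega>. 0 \<le> g i \<omega>"
    and sum: "\<And>\<omega>. ((\<lambda>i. g i \<omega>) has_sum f \<omega>) UNIV" and bound: "\<And>\<omega>. f \<omega> \<le> C"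
  shows "((\<lambda>i. expectation (g i)) has_sum expectation f) UNIV"
proof -
  let ?g = "\<lambda>n. g (prod_decode n)"
  have s: "((\<lambda>n. ?g n \<omega>) has_sum f \<omega>) UNIV" for \<omega>
    using sum[of \<omega>] has_sum_reindex_bij_betw[OF bij_prod_decode, of "\<lambda>i. g i \<omega>"] by simp
  have le: "sum (\<lambda>n. ?g n \<omega>) F \<le> C" if "finite F" for F \<omega>
    using has_sum_mono2[OF has_sum_finite[OF that] s] nonneg bound[of \<omega>] by (fastforce intro: order_trans)
  have gC: "g i \<omega> \<le> C" for i \<omega>
    using le[of "{prod_encode i}" \<omega>] by simp
  have int: "integrable M (g i)" for i
    by (rule integrable_const_bound[of _ C]) (use nonneg gC in auto)
  have nn: "norm (?g n \<omega>) = ?g n \<omega>" for n \<omega> using nonneg by simp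
  have "(\<lambda>n. expectation (?g n)) sums expectation (\<lambda>\<omega>. \<Sum>n. ?g n \<omega>)"
  proof (rule sums_integral[OF int])
    show "AE \<omega> in M. summable (\<lambda>n. norm (?g n \<omega>))"
      unfolding nn using has_sum_imp_sums[OF s] by (auto dest: sums_summable)
    show "summable (\<lambda>n. \<integral>\<omega>. norm (?g n \<omega>) \<partial>M)"
      unfolding nn
    proof (rule summableI_nonneg_bounded)
      show "(\<Sum>n<N. expectation (?g n)) \<le> C" for N
      proof -
        have "(\<Sum>n<N. expectation (?g n)) = expectation (\<lambda>\<omega>. \<Sum>n<N. ?g n \<omega>)"
          using int by (simp add: Bochner_Integration.integral_sum)
        also have "\<dots> \<le> expectation (\<lambda>_. C)"
          using int le by (intro integral_mono) auto
        finally show ?thesis by (simp add: prob_space)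
      qed
    qed (use nonneg in auto)
  qed
  then have "(\<lambda>n. expectation (?g n)) sums expectation f"
    using has_sum_imp_sums[OF s] by (simp add: sums_iff)
  then have "((\<lambda>n. expectation (?g n)) has_sum expectation f) UNIV"
    using nonneg by (intro sums_nonneg_imp_has_sum) auto
  then show ?thesis
    using has_sum_reindex_bij_betw[OF bij_prod_decode, of "\<lambda>i. expectation (g i)"] by simp
qed

end

section \<open>Zero state probability of the queue and of its time change\<close>

lemma erlang_queue_zero_probability:
  assumes M: "prob_space M" and lam: "0 < lam" and mu: "0 < mu" and k: "1 \<le> k"
    and Q: "erlang_queue M lam mu k Q" and t: "0 \<le> t"
  shows "((\<lambda>(m, r). A0 lam mu k (Suc m) r * (t ^ (m + r * (k + 1)) / fact (m + r * (k + 1)) * exp (- ((lam + real k * mu) * t))))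
    has_sum measure M {\<omega> \<in> space M. Q t \<omega> = (0, 0)}) UNIV"
proof -
  interpret prob_space M by (rule M)
  let ?S = "erlang_states k"
  have z: "(0, 0) \<in> ?S" by (simp add: erlang_states_def)
  obtain P where meas: "\<And>t. 0 \<le> t \<Longrightarrow> Q t \<in> M \<rightarrow>\<^sub>M count_space ?S"
    and Q0: "AE \<omega> in M. Q 0 \<omega> = (0, 0)" and P: "transition_function ?S P"
    and deriv: "\<And>i j. i \<in> ?S \<Longrightarrow> j \<in> ?S \<Longrightarrow> ((\<lambda>t. P t i j) has_real_derivative q_matrix ?S (erlang_rate lam mu k) i j) (at_right 0)"
    and mp: "markov_process M ?S P Q"
    using Q unfolding erlang_queue_def markov_chain_with_rates_def by blast
  have ev: "{\<omega> \<in> space M. Q u \<omega> = (0, 0)} \<in> events" if "0 \<le> u" for u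
    using measurable_sets[OF meas[OF that], of "{(0, 0)}"] z by (simp add: vimage_def Int_def conj_commute)
  have p0: "prob {\<omega> \<in> space M. Q 0 \<omega> = (0, 0)} = 1"
    using Q0 ev[of 0] by (subst prob_Collect_eq_1) auto
  have "prob {\<omega> \<in> space M. Q t \<omega> = (0, 0)} = P t (0, 0) (0, 0)"
  \<comment> \<open>The Markov property speaks of strictly increasing times, so \<open>t = 0\<close>
    is separate; for \<open>t > 0\<close> its instance with \<open>n = 0\<close> and the times
    \<open>0\<close> and \<open>t\<close> conditions on an event of probability one.\<close>
  proof (cases "t = 0")
    case True
    then show ?thesis using p0 transition_function_0[OF P z z] by simp
  next
    case False
    then have t0: "0 < t" using t by simp
    define tt where "tt i = (if i = 0 then 0 else t)" for i :: nat
    have "\<P>(\<omega> in M. Q (tt (Suc 0)) \<omega> = (0, 0) \<bar> \<forall>i\<le>0. Q (tt i) \<omega> = (0, 0)) = P (tt (Suc 0) - tt 0) (0, 0) (0, 0)"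
      using mp[unfolded markov_process_def, rule_format, of tt 0 "\<lambda>_. (0, 0)"] z p0 t0
      by (auto simp: tt_def strict_mono_on_def)
    then have "\<P>(\<omega> in M. Q t \<omega> = (0, 0) \<bar> Q 0 \<omega> = (0, 0)) = P t (0, 0) (0, 0)" by (simp add: tt_def)
    then have "prob {\<omega> \<in> space M. Q t \<omega> = (0, 0) \<and> Q 0 \<omega> = (0, 0)} = P t (0, 0) (0, 0)"
      by (simp add: cond_prob_def p0)
    moreover have "prob {\<omega> \<in> space M. Q t \<omega> = (0, 0) \<and> Q 0 \<omega> = (0, 0)} = prob {\<omega> \<in> space M. Q t \<omega> = (0, 0)}"
    proof (rule finite_measure_eq_AE)
      show "AE \<omega> in M. (\<omega> \<in> {\<omega> \<in> space M. Q t \<omega> = (0, 0) \<and> Q 0 \<omega> = (0, 0)}) = (\<omega> \<in> {\<omega> \<in> space M. Q t \<omega> = (0, 0)})"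
        using Q0 by eventually_elim auto
      show "{\<omega> \<in> space M. Q t \<omega> = (0, 0) \<and> Q 0 \<omega> = (0, 0)} \<in> events"
        using sets.Int[OF ev[OF t] ev[of 0]] by (simp add: Int_def) (metis (no_types, lifting) Collect_cong)
    qed (rule ev[OF t])
    ultimately show ?thesis by simp
  qed
  then show ?thesis using erlang_transition_has_sum[OF k lam mu P deriv t] by simp
qed

lemma power_div_fact_le_exp:
  fixes x :: real
  assumes "0 \<le> x"
  shows "x ^ n / fact n \<le> exp x"
proof -
  have "(\<lambda>n. x ^ n /\<^sub>R fact n) sums exp x" by (rule exp_converges)
  then have "(\<Sum>i\<in>{n}. x ^ i /\<^sub>R fact i) \<le> exp x"
    unfolding sums_iff using assms sum_le_suminf[of "\<lambda>n. x ^ n /\<^sub>R fact n" "{n}"] by auto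
  then show ?thesis by (simp add: divide_inverse mult.commute)
qed

lemma power_exp_bound:
  fixes L y :: real
  assumes "0 < L" "0 \<le> y"
  shows "\<bar>y ^ n / fact n * exp (- (L * y))\<bar> \<le> 1 / L ^ n"
proof -
  have "(L * y) ^ n / fact n \<le> exp (L * y)" using assms by (intro power_div_fact_le_exp) auto
  then have "y ^ n / fact n * exp (- (L * y)) \<le> 1 / L ^ n"
    using assms by (simp add: exp_minus power_mult_distrib field_simps)
  then show ?thesis using assms by simp
qed

text \<open>The denominator is \<open>z powr - \<alpha>1 / c1\<close> times
  \<open>L + (c1 * z powr \<alpha>1 + c2 * z powr \<alpha>2)\<close>, so
  \<open>z powr - \<alpha>1\<close> cancels and only \<open>z powr - (\<delta> / real N)\<close>
  survives, whose \<open>N\<close>-th power is free of \<open>N\<close>.\<close>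

lemma laplace_queue_factor:
  fixes z :: real
  assumes z: "0 < z" and c1: "0 < c1" and pos: "0 < L + (c1 * z powr \<alpha>1 + c2 * z powr \<alpha>2)" and N: "1 \<le> N"
  shows "(z powr - (\<alpha>1 + \<delta> / real N) / (1 + c2 / c1 * z powr - (\<alpha>1 - \<alpha>2) + L / c1 * z powr - \<alpha>1)) ^ N
    = z powr - \<delta> * c1 ^ N / (L + (c1 * z powr \<alpha>1 + c2 * z powr \<alpha>2)) ^ N"
proof -
  let ?d = "L + (c1 * z powr \<alpha>1 + c2 * z powr \<alpha>2)"
  have "1 + c2 / c1 * z powr - (\<alpha>1 - \<alpha>2) + L / c1 * z powr - \<alpha>1 = z powr - \<alpha>1 * ?d / c1"
  proof -
    have "z powr - (\<alpha>1 - \<alpha>2) = z powr - \<alpha>1 * z powr \<alpha>2" using z by (simp add: powr_add[symmetric])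
    moreover have "z powr - \<alpha>1 * z powr \<alpha>1 = 1" using z by (simp add: powr_add[symmetric])
    ultimately show ?thesis using c1 by (simp add: field_simps)
  qed
  moreover have "z powr - (\<alpha>1 + \<delta> / real N) = z powr - \<alpha>1 * z powr - (\<delta> / real N)"
    using z by (simp add: powr_add[symmetric])
  ultimately have "z powr - (\<alpha>1 + \<delta> / real N) / (1 + c2 / c1 * z powr - (\<alpha>1 - \<alpha>2) + L / c1 * z powr - \<alpha>1)
      = z powr - (\<delta> / real N) * c1 / ?d"
    using z c1 pos by simp
  moreover have "(z powr - (\<delta> / real N)) ^ N = z powr - \<delta>"
    using z N by (simp add: powr_power)
  ultimately show ?thesis by (simp add: power_divide power_mult_distrib)
qed

text \<open>For \<open>\<delta> = 1 - \<alpha>1\<close> and \<open>\<delta> = 1 - \<alpha>2\<close>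
  the two transforms, weighted by \<open>c1\<close> and \<open>c2\<close>, add up to
  \<open>\<psi> z / z * (c1 / (L + \<psi> z)) ^ N\<close>; the division by \<open>c1 ^ N\<close>
  removes the constant.\<close>

lemma (in subordinator) expectation_eq_convolution_powers:
  fixes lam mu :: real
  assumes lam: "0 < lam" and mu: "0 < mu" and \<alpha>: "0 < \<alpha>2" "\<alpha>2 < \<alpha>1" "\<alpha>1 < 1" and c: "0 < c1" "0 \<le> c2"
    and \<psi>: "\<And>z. \<psi> z = c1 * z powr \<alpha>1 + c2 * z powr \<alpha>2" and t: "0 < t" and N: "1 \<le> N"
  shows "(c1 * convolution_power N (queue_f lam mu k \<alpha>1 \<alpha>2 c1 c2 N) t +
      c2 * convolution_power N (queue_g lam mu k \<alpha>1 \<alpha>2 c1 c2 N) t) / c1 ^ N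
    = expectation (\<lambda>\<omega>. Y t \<omega> ^ (N - 1) / fact (N - 1) * exp (- ((lam + real k * mu) * Y t \<omega>)))"
proof -
  define L where "L = lam + real k * mu"
  have L: "0 < L" using lam mu by (simp add: L_def add_pos_nonneg)
  obtain n where n: "N = Suc n" using N by (cases N) auto
  \<comment> \<open>Both exponents are negative, the first because
    \<open>\<alpha>2 < \<alpha>1\<close>, so the smallness needed for the Mittag-Leffler expansion
    holds at some \<open>Z\<close>.\<close>
  have "((\<lambda>z. c2 / c1 * z powr - (\<alpha>1 - \<alpha>2) + L / c1 * z powr - \<alpha>1) \<longlongrightarrow> c2 / c1 * 0 + L / c1 * 0) at_top"
    using \<alpha> by (intro tendsto_intros tendsto_neg_powr filterlim_ident) auto
  then have "\<forall>\<^sub>F z in at_top. c2 / c1 * z powr - (\<alpha>1 - \<alpha>2) + L / c1 * z powr - \<alpha>1 < 1"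
    by (intro order_tendstoD) auto
  from eventually_happens'[OF _ eventually_conj[OF this eventually_gt_at_top[of 0]]]
  obtain Z where Z: "c2 / c1 * Z powr - (\<alpha>1 - \<alpha>2) + L / c1 * Z powr - \<alpha>1 < 1" "0 < Z" by auto
  let ?l = "\<lambda>\<delta> z. z powr - (\<alpha>1 + \<delta> / real N) / (1 + c2 / c1 * z powr - (\<alpha>1 - \<alpha>2) + L / c1 * z powr - \<alpha>1)"
  have gs: "gamma_series Z (\<lambda>t. t powr (\<alpha>1 + \<delta> / real N - 1) * (\<Sum>h. (- (c2 / c1)) ^ h * t powr ((\<alpha>1 - \<alpha>2) * real h) *
        mittag_leffler3 \<alpha>1 (\<alpha>1 + (\<alpha>1 - \<alpha>2) * real h + \<delta> / real N) (real h + 1) (- (L / c1) * t powr \<alpha>1))) (?l \<delta>)"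
    if "0 < \<delta>" for \<delta>
    using that \<alpha> c L Z N by (intro gamma_series_mittag_leffler) auto
  have e: "\<alpha>1 - (x - 1) / real N - 1 = \<alpha>1 + (1 - x) / real N - 1" for x
    by (simp add: diff_divide_distrib)
  have f: "gamma_series Z (queue_f lam mu k \<alpha>1 \<alpha>2 c1 c2 N) (?l (1 - \<alpha>1))"
    and g: "gamma_series Z (queue_g lam mu k \<alpha>1 \<alpha>2 c1 c2 N) (?l (1 - \<alpha>2))"
    using gs[of "1 - \<alpha>1"] gs[of "1 - \<alpha>2"] \<alpha> by (simp_all add: queue_f_def[abs_def] queue_g_def[abs_def] e L_def)
  let ?F = "convolution_power N (queue_f lam mu k \<alpha>1 \<alpha>2 c1 c2 N)"
  let ?G = "convolution_power N (queue_g lam mu k \<alpha>1 \<alpha>2 c1 c2 N)"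
  have F: "gamma_series Z ?F (\<lambda>z. ?l (1 - \<alpha>1) z ^ N)" by (rule gamma_series_convolution_power[OF f Z(2) N])
  have G: "gamma_series Z ?G (\<lambda>z. ?l (1 - \<alpha>2) z ^ N)" by (rule gamma_series_convolution_power[OF g Z(2) N])
  let ?H = "\<lambda>t. expectation (\<lambda>\<omega>. Y t \<omega> ^ n / fact n * exp (- (L * Y t \<omega>)))"
  have "(c1 * ?F t + c2 * ?G t) / c1 ^ N = ?H t"
  proof (rule laplace_unique_right_continuous[where l="\<lambda>z. \<psi> z / z / (L + \<psi> z) ^ Suc n" and Z=Z, OF _ _ t])
    fix z assume z: "Z \<le> z"
    then have z0: "0 < z" using Z by simp
    have pos: "0 < L + (c1 * z powr \<alpha>1 + c2 * z powr \<alpha>2)" using exponent_pos[OF z0] L by (simp add: \<psi>)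
    have val: "?l \<delta> z ^ N = z powr - \<delta> * c1 ^ N / (L + \<psi> z) ^ N" for \<delta>
      unfolding \<psi> by (rule laplace_queue_factor[OF z0 c(1) pos N])
    have pw: "z powr - (1 - x) = z powr x / z" for x
      using z0 by (simp add: powr_diff)
    have "(c1 * ?l (1 - \<alpha>1) z ^ N + c2 * ?l (1 - \<alpha>2) z ^ N) / c1 ^ N = \<psi> z / z / (L + \<psi> z) ^ N"
    proof -
      have "(c1 * (a / z * K / E) + c2 * (b / z * K / E)) / K = (c1 * a + c2 * b) / z / E"
        if "K \<noteq> 0" "E \<noteq> 0" for a b K E :: real using that z0 by (simp add: field_simps)
      then show ?thesis unfolding val pw using c(1) pos by (simp add: \<psi>)
    qed
    moreover have "has_bochner_integral lborel
      (\<lambda>t. (c1 * (indicator {0<..} t * (?F t * exp (- (z * t)))) + c2 * (indicator {0<..} t * (?G t * exp (- (z * t))))) / c1 ^ N)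
      ((c1 * ?l (1 - \<alpha>1) z ^ N + c2 * ?l (1 - \<alpha>2) z ^ N) / c1 ^ N)"
      by (intro has_bochner_integral_divide_zero has_bochner_integral_add has_bochner_integral_mult_right
          gamma_series_laplace[OF F Z(2) z] gamma_series_laplace[OF G Z(2) z])
    moreover have "(c1 * (indicator {0<..} t * (?F t * exp (- (z * t)))) + c2 * (indicator {0<..} t * (?G t * exp (- (z * t))))) / c1 ^ N
      = indicator {0<..} t * ((c1 * ?F t + c2 * ?G t) / c1 ^ N * exp (- (z * t)))" for t
      by (simp add: indicator_def algebra_simps)
    ultimately show "has_bochner_integral lborel (\<lambda>t. indicator {0<..} t * ((c1 * ?F t + c2 * ?G t) / c1 ^ N * exp (- (z * t))))
      (\<psi> z / z / (L + \<psi> z) ^ Suc n)"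
      by (simp only: n)
    show "has_bochner_integral lborel (\<lambda>t. indicator {0<..} t * (?H t * exp (- (z * t)))) (\<psi> z / z / (L + \<psi> z) ^ Suc n)"
      by (rule laplace_transform_expectation_Y[OF L z0 power_exp_bound[OF L]])
  next
    have cont: "(?F \<longlongrightarrow> ?F t) (at_right t)" "(?G \<longlongrightarrow> ?G t) (at_right t)"
      using gamma_series_continuous_on[OF F Z(2)] gamma_series_continuous_on[OF G Z(2)] t
      by (auto simp: continuous_on_eq_continuous_at isCont_def intro: filterlim_at_within_If tendsto_within_subset[where S=UNIV])
    then show "((\<lambda>t. (c1 * ?F t + c2 * ?G t) / c1 ^ N) \<longlongrightarrow> (c1 * ?F t + c2 * ?G t) / c1 ^ N) (at_right t)"
      using c by (intro tendsto_intros) auto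
    show "(?H \<longlongrightarrow> ?H t) (at_right t)"
      by (rule expectation_Y_right_continuous[OF _ power_exp_bound[OF L] t]) (intro continuous_intros, auto)
  qed
  then show ?thesis by (simp add: n L_def)
qed

theorem theorem3p2:
  fixes M :: "'w measure" and lam mu \<alpha>1 \<alpha>2 c1 c2 t :: real and k :: nat
    and Q :: "real \<Rightarrow> 'w \<Rightarrow> nat \<times> nat" and D :: "real \<Rightarrow> 'w \<Rightarrow> real"
  assumes "prob_space M"
    and "lam > 0" and "mu > 0" and "k \<ge> 1"
    and "0 < \<alpha>2" and "\<alpha>2 < \<alpha>1" and "\<alpha>1 < 1"
    and "c1 > 0" and "c2 \<ge> 0" and "c1 + c2 = 1"
    and "erlang_queue M lam mu k Q"
    and "mixed_stable_subordinator M \<alpha>1 \<alpha>2 c1 c2 D"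
    and "indep_processes M (count_space (erlang_states k)) Q borel (inverse_subordinator D)"
    and "t > 0"
  shows "(\<forall>m\<ge>1. summable (zero_state_term lam mu k \<alpha>1 \<alpha>2 c1 c2 t m)) \<and>
    (\<lambda>m. \<Sum>r. zero_state_term lam mu k \<alpha>1 \<alpha>2 c1 c2 t (Suc m) r)
      sums zero_state_probability M (time_changed Q (inverse_subordinator D)) t"
proof -
  define \<psi> where "\<psi> z = c1 * z powr \<alpha>1 + c2 * z powr \<alpha>2" for z
  interpret prob_space M by (rule assms(1))
  interpret subordinator M D \<psi>
    using assms(12) \<open>c1 > 0\<close> \<open>c2 \<ge> 0\<close>
    by unfold_locales (auto simp: mixed_stable_subordinator_def \<psi>_def intro!: add_pos_nonneg)
  let ?S = "erlang_states k" and ?L = "lam + real k * mu"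
  have z: "(0, 0) \<in> ?S" by (simp add: erlang_states_def)
  have L: "0 < ?L" using assms(2,3) by (intro add_pos_nonneg) auto
  have meas: "\<And>u. 0 \<le> u \<Longrightarrow> Q u \<in> M \<rightarrow>\<^sub>M count_space ?S"
    and rc: "\<And>\<omega> u. \<omega> \<in> space M \<Longrightarrow> 0 \<le> u \<Longrightarrow> \<forall>\<^sub>F v in at_right u. Q v \<omega> = Q u \<omega>"
    and Q0: "AE \<omega> in M. Q 0 \<omega> = (0, 0)"
    using assms(11) unfolding erlang_queue_def markov_chain_with_rates_def by blast+
  let ?E = "\<lambda>u. {\<omega> \<in> space M. Q u \<omega> = (0, 0)}"
  have vim: "?E u = Q u -` {(0, 0)} \<inter> space M" for u by auto
  have ev: "?E u \<in> events" if "0 \<le> u" for u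
    using measurable_sets[OF meas[OF that], of "{(0, 0)}"] z unfolding vim by simp
  have indep: "prob (?E u \<inter> (Y t -` B \<inter> space M)) = prob (?E u) * prob (Y t -` B \<inter> space M)"
    if "0 \<le> u" "B \<in> sets borel" for u B
    using assms(13) unfolding indep_processes_def
  proof (rule indep_setD)
    show "?E u \<in> generated_events M (count_space ?S) Q"
      unfolding generated_events_def vim using that z by (intro sigma_sets.Basic) auto
    show "Y t -` B \<inter> space M \<in> generated_events M borel Y"
      unfolding generated_events_def using that assms(14) by (intro sigma_sets.Basic CollectI exI[of _ t] exI[of _ B]) auto
  qed
  define \<phi> where "\<phi> n y = y ^ n / fact n * exp (- (?L * y))" for n and y :: real
  have \<phi>0: "0 \<le> \<phi> n y" if "0 \<le> y" for n y using that by (simp add: \<phi>_def)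
  have A00: "0 \<le> A0 lam mu k m r" for m r using assms(2,3) by (simp add: A0_def)
  note measurable_Y[measurable]
  note tc = prob_time_change[of Q "(0, 0)" "Y t", OF ev rc measurable_Y Y_nonneg indep]
  have "zero_state_probability M (time_changed Q Y) t = prob {\<omega> \<in> space M. Q (Y t \<omega>) \<omega> = (0, 0)}"
  proof -
    \<comment> \<open>By convention \<open>Y 0\<close> is \<open>0\<close> everywhere, so the
      conditioning event is that \<open>Q 0\<close> is \<open>(0, 0)\<close>, of probability
      one.\<close>
    have p0: "prob {\<omega> \<in> space M. Q 0 \<omega> = (0, 0)} = 1"
      using Q0 ev[of 0] by (subst prob_Collect_eq_1) auto
    have Y0: "Y 0 \<omega> = 0" for \<omega> by (simp add: inverse_subordinator_def)
    have "prob {\<omega> \<in> space M. Q (Y t \<omega>) \<omega> = (0, 0) \<and> Q 0 \<omega> = (0, 0)} = prob {\<omega> \<in> space M. Q (Y t \<omega>) \<omega> = (0, 0)}"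
    proof (rule finite_measure_eq_AE)
      show "AE \<omega> in M. (\<omega> \<in> {\<omega> \<in> space M. Q (Y t \<omega>) \<omega> = (0, 0) \<and> Q 0 \<omega> = (0, 0)}) = (\<omega> \<in> {\<omega> \<in> space M. Q (Y t \<omega>) \<omega> = (0, 0)})"
        using Q0 by eventually_elim auto
      have "{\<omega> \<in> space M. Q (Y t \<omega>) \<omega> = (0, 0) \<and> Q 0 \<omega> = (0, 0)} = {\<omega> \<in> space M. Q (Y t \<omega>) \<omega> = (0, 0)} \<inter> ?E 0" by auto
      then show "{\<omega> \<in> space M. Q (Y t \<omega>) \<omega> = (0, 0) \<and> Q 0 \<omega> = (0, 0)} \<in> events"
        by (rule ssubst) (rule sets.Int[OF tc(1) ev[OF order_refl]])
    qed (rule tc(1))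
    then show ?thesis
      by (simp add: zero_state_probability_def cond_prob_def time_changed_def Y0 p0)
  qed
  also have "\<dots> = expectation (\<lambda>\<omega>. prob (?E (Y t \<omega>)))"
    by (rule tc(2))
  finally have zsp: "zero_state_probability M (time_changed Q Y) t = expectation (\<lambda>\<omega>. prob (?E (Y t \<omega>)))" .
  have "((\<lambda>i. expectation (\<lambda>\<omega>. case i of (m, r) \<Rightarrow> A0 lam mu k (Suc m) r * \<phi> (m + r * (k + 1)) (Y t \<omega>)))
    has_sum expectation (\<lambda>\<omega>. prob (?E (Y t \<omega>)))) UNIV"
  proof (rule has_sum_expectation_nonneg[where C=1])
    show "((\<lambda>i. case i of (m, r) \<Rightarrow> A0 lam mu k (Suc m) r * \<phi> (m + r * (k + 1)) (Y t \<omega>)) has_sum prob (?E (Y t \<omega>))) UNIV" for \<omega>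
      using erlang_queue_zero_probability[OF assms(1,2,3,4,11) Y_nonneg, of t \<omega>] by (simp add: \<phi>_def)
    show "(\<lambda>\<omega>. case i of (m, r) \<Rightarrow> A0 lam mu k (Suc m) r * \<phi> (m + r * (k + 1)) (Y t \<omega>)) \<in> borel_measurable M" for i
      unfolding \<phi>_def by (cases i) (simp, measurable)
  qed (auto intro!: mult_nonneg_nonneg A00 \<phi>0 Y_nonneg split: prod.split)
  moreover have "expectation (\<lambda>\<omega>. case i of (m, r) \<Rightarrow> A0 lam mu k (Suc m) r * \<phi> (m + r * (k + 1)) (Y t \<omega>))
    = (case i of (m, r) \<Rightarrow> zero_state_term lam mu k \<alpha>1 \<alpha>2 c1 c2 t (Suc m) r)" for i
  proof -
    obtain m r where i: "i = (m, r)" by (cases i)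
    let ?N = "a0 k (Suc m) r"
    \<comment> \<open>Since the first index is \<open>Suc m\<close>, the subtraction in
      \<open>?N - 1\<close> is not truncated and gives the exponent of the queue series.\<close>
    have N: "1 \<le> ?N" "?N - 1 = m + r * (k + 1)" by (auto simp: a0_def)
    have "expectation (\<lambda>\<omega>. \<phi> (m + r * (k + 1)) (Y t \<omega>)) = (c1 * convolution_power ?N (queue_f lam mu k \<alpha>1 \<alpha>2 c1 c2 ?N) t +
      c2 * convolution_power ?N (queue_g lam mu k \<alpha>1 \<alpha>2 c1 c2 ?N) t) / c1 ^ ?N"
      using expectation_eq_convolution_powers[OF assms(2,3,5-9) \<psi>_def assms(14) N(1), of k]
      unfolding N(2) \<phi>_def by simp
    then show ?thesis by (simp add: i zero_state_term_def)
  qed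
  \<comment> \<open>Summability over pairs is unconditional, so it yields both the convergence in
    \<open>r\<close> for each \<open>m\<close> and the iterated sum in the order of the
    claim.\<close>
  ultimately have S: "((\<lambda>(m, r). zero_state_term lam mu k \<alpha>1 \<alpha>2 c1 c2 t (Suc m) r)
      has_sum zero_state_probability M (time_changed Q Y) t) (SIGMA m:UNIV. UNIV)"
    by (simp add: zsp)
  have inner: "zero_state_term lam mu k \<alpha>1 \<alpha>2 c1 c2 t (Suc m) summable_on UNIV" for m
    by (rule summable_on_SigmaD1[of "\<lambda>m. zero_state_term lam mu k \<alpha>1 \<alpha>2 c1 c2 t (Suc m)" UNIV "\<lambda>_. UNIV"])
      (use S in \<open>auto simp: summable_on_def\<close>)
  then have s: "summable (zero_state_term lam mu k \<alpha>1 \<alpha>2 c1 c2 t (Suc m))" for m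
    by (rule summable_on_imp_summable)
  have "((\<lambda>m. infsum (zero_state_term lam mu k \<alpha>1 \<alpha>2 c1 c2 t (Suc m)) UNIV)
    has_sum zero_state_probability M (time_changed Q Y) t) UNIV"
    by (rule has_sum_SigmaD[OF S]) (use inner in simp)
  then have "(\<lambda>m. infsum (zero_state_term lam mu k \<alpha>1 \<alpha>2 c1 c2 t (Suc m)) UNIV)
    sums zero_state_probability M (time_changed Q Y) t" by (rule has_sum_imp_sums)
  moreover have "infsum (zero_state_term lam mu k \<alpha>1 \<alpha>2 c1 c2 t (Suc m)) UNIV = (\<Sum>r. zero_state_term lam mu k \<alpha>1 \<alpha>2 c1 c2 t (Suc m) r)" for m
    using has_sum_imp_sums[OF has_sum_infsum[OF inner]] by (simp add: sums_iff)
  moreover have "summable (zero_state_term lam mu k \<alpha>1 \<alpha>2 c1 c2 t m)" if "1 \<le> m" for m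
    using s[of "m - 1"] that by simp
  ultimately show ?thesis by simp
qed

end
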